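(* For every $(A,B,C,D)\in\mathbb{C}^4$ there is a dense set $\mathcal{J}^{\#}_{A,B,C,D}\subset\mathcal{J}_{A,B,C,D}$ such that for every $p\in\mathcal{J}^{\#}_{A,B,C,D}$ there exists $\gamma\in\mathcal{G}_{A,B,C,D}$ such that $\gamma(p)=p$ and $D\gamma(p)$ is conjugate to $\begin{pmatrix}1&1\\0&1\end{pmatrix}$.
   Context: For $(A,B,C,D)\in\mathbb{C}^4$ let $S_{A,B,C,D}=\{(x,y,z)\in\mathbb{C}^3: x^2+y^2+z^2+xyz=Ax+By+Cz+D\}$. The involutions $s_x(x,y,z)=(-x-yz+A,\,y,\,z)$, $s_y(x,y,z)=(x,\,-y-xz+B,\,z)$, $s_z(x,y,z)=(x,\,y,\,-z-xy+C)$ preserve $S_{A,B,C,D}$. Let $\mathcal{G}_{A,B,C,D}=\langle g_x,g_y,g_z\rangle$ be the group of automorphisms of $S_{A,B,C,D}$ generated by $g_x=s_z\circ s_y$, $g_y=s_x\circ s_z$, $g_z=s_y\circ s_x$. $D\gamma(p)$ denotes the derivative of $\gamma$, as an automorphism of the surface $S_{A,B,C,D}$, at a smooth fixed point $p$, acting on the two-dimensional complex tangent space $T_pS_{A,B,C,D}$. A sequence of maps $f_i$ converges to infinity on an open set $U\subset S_{A,B,C,D}$ if for every compact $\overline V\subset U$ and every compact $K\subset S_{A,B,C,D}$ only finitely many $i$ satisfy $f_i(\overline V)\cap K\neq\emptyset$. The group $\mathcal{G}_{A,B,C,D}$ forms a normal family on $U$ if every sequence of its elements has a subsequence that, on $U$,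 either converges uniformly on compact subsets or converges to infinity. The Fatou set $\mathcal{F}_{A,B,C,D}$ is the set of $p\in S_{A,B,C,D}$ having an open neighborhood on which $\mathcal{G}_{A,B,C,D}$ forms a normal family; the Julia set is $\mathcal{J}_{A,B,C,D}=S_{A,B,C,D}\setminus\mathcal{F}_{A,B,C,D}$. *)

theory Defs
  imports "HOL-Analysis.Analysis" "HOL-Algebra.Bij" "HOL-Algebra.Generated_Groups"
begin

definition surface_poly :: "complex \<Rightarrow> complex \<Rightarrow> complex \<Rightarrow> complex \<Rightarrow> complex^3 \<Rightarrow> complex" where
  "surface_poly A B C D p =
     (p$1)\<^sup>2 + (p$2)\<^sup>2 + (p$3)\<^sup>2 + p$1 * p$2 * p$3 - (A * p$1 + B * p$2 + C * p$3 + D)"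

definition surface :: "complex \<Rightarrow> complex \<Rightarrow> complex \<Rightarrow> complex \<Rightarrow> (complex^3) set" where
  "surface A B C D =
     {p. (p$1)\<^sup>2 + (p$2)\<^sup>2 + (p$3)\<^sup>2 + p$1 * p$2 * p$3 = A * p$1 + B * p$2 + C * p$3 + D}"

lemma surface_eq_zero_set: "surface A B C D = {p. surface_poly A B C D p = 0}"
  by (simp add: surface_def surface_poly_def)

definition inv_x :: "complex \<Rightarrow> complex^3 \<Rightarrow> complex^3" where
  "inv_x A p = vector [- p$1 - p$2 * p$3 + A, p$2, p$3]"

definition inv_y :: "complex \<Rightarrow> complex^3 \<Rightarrow> complex^3" where
  "inv_y B p = vector [p$1, - p$2 - p$1 * p$3 + B, p$3]"

definition inv_z :: "complex \<Rightarrow> complex^3 \<Rightarrow> complex^3" where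
  "inv_z C p = vector [p$1, p$2, - p$3 - p$1 * p$2 + C]"

definition surface_generators ::
    "complex \<Rightarrow> complex \<Rightarrow> complex \<Rightarrow> complex \<Rightarrow> (complex^3 \<Rightarrow> complex^3) set" where
  "surface_generators A B C D =
     {restrict (inv_z C \<circ> inv_y B) (surface A B C D),
      restrict (inv_x A \<circ> inv_z C) (surface A B C D),
      restrict (inv_y B \<circ> inv_x A) (surface A B C D)}"

text \<open>The generators are bijections of the surface, so that the group they generate inside
  \<^const>\<open>BijGroup\<close> consists of maps of the surface only (extended by \<^const>\<open>undefined\<close>
  off the surface).\<close>

definition surface_group ::
    "complex \<Rightarrow> complex \<Rightarrow> complex \<Rightarrow> complex \<Rightarrow> (complex^3 \<Rightarrow> complex^3) set" where
  "surface_group A B C D =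
     generate (BijGroup (surface A B C D)) (surface_generators A B C D)"

lemma involutions_surface:
  assumes "p \<in> surface A B C D"
  shows "inv_x A p \<in> surface A B C D" "inv_y B p \<in> surface A B C D" "inv_z C p \<in> surface A B C D"
  using assms
  by (simp_all add: surface_def inv_x_def inv_y_def inv_z_def power2_eq_square algebra_simps)

lemma involutions_involutive:
  "inv_x A (inv_x A p) = p" "inv_y B (inv_y B p) = p" "inv_z C (inv_z C p) = p"
  by (simp_all add: inv_x_def inv_y_def inv_z_def vec_eq_iff forall_3)

lemma surface_generators_subset_Bij:
  "surface_generators A B C D \<subseteq> carrier (BijGroup (surface A B C D))"
proof -
  have bij: "bij_betw f (surface A B C D) (surface A B C D)"
    if "f \<in> {inv_x A, inv_y B, inv_z C}" for f
    by (rule bij_betwI[where g = f])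
      (use that in \<open>auto simp: involutions_surface involutions_involutive\<close>)
  have "restrict (f \<circ> g) (surface A B C D) \<in> Bij (surface A B C D)"
    if "f \<in> {inv_x A, inv_y B, inv_z C}" "g \<in> {inv_x A, inv_y B, inv_z C}" for f g
    using bij_betw_trans[OF bij[OF that(2)] bij[OF that(1)]]
    by (simp add: Bij_def cong: bij_betw_cong)
  then show ?thesis
    by (auto simp: surface_generators_def BijGroup_def)
qed

definition converges_to_infinity_on ::
    "'a::topological_space set \<Rightarrow> 'a set \<Rightarrow> (nat \<Rightarrow> 'a \<Rightarrow> 'a) \<Rightarrow> bool" where
  "converges_to_infinity_on S U f \<longleftrightarrow>
     (\<forall>V K. compact V \<and> V \<subseteq> U \<and> compact K \<and> K \<subseteq> S \<longrightarrow> finite {i. f i ` V \<inter> K \<noteq> {}})"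

definition converges_uniformly_on_compacts ::
    "'a::metric_space set \<Rightarrow> (nat \<Rightarrow> 'a \<Rightarrow> 'a) \<Rightarrow> bool" where
  "converges_uniformly_on_compacts U f \<longleftrightarrow>
     (\<exists>g. \<forall>V. compact V \<and> V \<subseteq> U \<longrightarrow> uniform_limit V f g sequentially)"

definition normal_family_on ::
    "'a::metric_space set \<Rightarrow> ('a \<Rightarrow> 'a) set \<Rightarrow> 'a set \<Rightarrow> bool" where
  "normal_family_on S G U \<longleftrightarrow>
     (\<forall>f :: nat \<Rightarrow> 'a \<Rightarrow> 'a. (\<forall>n. f n \<in> G) \<longrightarrow>
        (\<exists>r. strict_mono r \<and>
           (converges_uniformly_on_compacts U (f \<circ> r) \<or> converges_to_infinity_on S U (f \<circ> r))))"

definition fatou_set :: "complex \<Rightarrow> complex \<Rightarrow> complex \<Rightarrow> complex \<Rightarrow> (complex^3) set" where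
  "fatou_set A B C D =
     {p \<in> surface A B C D. \<exists>U. openin (top_of_set (surface A B C D)) U \<and> p \<in> U \<and>
        normal_family_on (surface A B C D) (surface_group A B C D) U}"

definition julia_set :: "complex \<Rightarrow> complex \<Rightarrow> complex \<Rightarrow> complex \<Rightarrow> (complex^3) set" where
  "julia_set A B C D = surface A B C D - fatou_set A B C D"

definition surface_grad :: "complex \<Rightarrow> complex \<Rightarrow> complex \<Rightarrow> complex^3 \<Rightarrow> complex^3" where
  "surface_grad A B C p =
     vector [2 * p$1 + p$2 * p$3 - A, 2 * p$2 + p$1 * p$3 - B, 2 * p$3 + p$1 * p$2 - C]"

lemma surface_poly_has_derivative:
  "(surface_poly A B C D has_derivative (\<lambda>v. \<Sum>i\<in>UNIV. surface_grad A B C p $ i * v $ i)) (at p)"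
  unfolding surface_poly_def
  by (auto intro!: derivative_eq_intros bounded_linear_imp_has_derivative bounded_linear_vec_nth
      simp: surface_grad_def sum_3 algebra_simps fun_eq_iff)

definition smooth_point :: "complex \<Rightarrow> complex \<Rightarrow> complex \<Rightarrow> complex \<Rightarrow> complex^3 \<Rightarrow> bool" where
  "smooth_point A B C D p \<longleftrightarrow> p \<in> surface A B C D \<and> surface_grad A B C p \<noteq> 0"

definition tangent_plane :: "complex \<Rightarrow> complex \<Rightarrow> complex \<Rightarrow> complex^3 \<Rightarrow> (complex^3) set" where
  "tangent_plane A B C p = {v. (\<Sum>i\<in>UNIV. surface_grad A B C p $ i * v $ i) = 0}"

text \<open>At a smooth point \<open>p\<close>, differentiability of \<open>\<gamma>\<close> at \<open>p\<close> \<^emph>\<open>within the surface\<close> determines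
  the derivative \<open>L\<close> on the tangent plane at \<open>p\<close> (and nowhere else), where it is the derivative
  of \<open>\<gamma>\<close> as a map of the surface. Hence only the values of \<open>L\<close> on the tangent plane are used.
  Conjugacy of this endomorphism to a matrix \<open>M\<close> is expressed by a complex linear isomorphism
  \<open>\<phi>\<close> from \<open>\<complex>\<^sup>2\<close> onto the tangent plane.\<close>

definition surface_deriv_conjugate_to ::
    "complex \<Rightarrow> complex \<Rightarrow> complex \<Rightarrow> complex \<Rightarrow> (complex^3 \<Rightarrow> complex^3) \<Rightarrow> complex^3 \<Rightarrow>
      complex^2^2 \<Rightarrow> bool" where
  "surface_deriv_conjugate_to A B C D \<gamma> p M \<longleftrightarrow>
     (\<exists>L \<phi>. (\<gamma> has_derivative L) (at p within surface A B C D) \<and>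
        Vector_Spaces.linear (*s) (*s) \<phi> \<and> bij_betw \<phi> UNIV (tangent_plane A B C p) \<and>
        (\<forall>w. L (\<phi> w) = \<phi> (M *v w)))"

end

theory Submission
  imports Defs "HOL-Complex_Analysis.Great_Picard"
begin

text \<open>
  The map \<open>g\<^sub>x\<close> preserves each fibre of the first coordinate and acts on it as an affine map, whose
  linear part has eigenvalues \<open>l\<^sup>2\<close> and \<open>1/l\<^sup>2\<close> over \<open>x = - (l + 1/l)\<close>. If \<open>l\<close> is a root of unity
  other than \<open>1\<close> and \<open>-1\<close>, then a power of \<open>g\<^sub>x\<close> fixes the fibre pointwise; as the eigenvalue varies
  with \<open>x\<close>, its derivative is unipotent but not the identity, except at the centre of the conic.
  These \<open>x\<close> are dense in \<open>[-2, 2]\<close>, and only finitely many fibres contain their centre. The same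
  holds for the other two coordinates. The iterates of a parabolic germ have unbounded derivatives, so
  parabolic points lie in the Julia set.

  Let \<open>U\<close> be a neighbourhood of a smooth point of the surface without parabolic points. Parabolic
  points being permuted by the group, the coordinates of all maps of the group omit on \<open>U\<close> at least
  two values, and the group is normal near the point by the theorems of Schottky and Arzela-Ascoli.

  A singular point \<open>p\<close> is a fixed point of all three involutions. If its first coordinate is in
  \<open>[-2, 2]\<close>, nearby fibres consist of parabolic points. Otherwise \<open>g\<^sub>x\<close> is hyperbolic on the fibre of
  \<open>p\<close>, which is a pair of lines through \<open>p\<close>, and one of them is contracted to \<open>p\<close> by \<open>g\<^sub>x\<close>. This line
  contains a parabolic point of the map \<open>g\<^sub>y\<close>, whose orbit under \<open>g\<^sub>x\<close> accumulates at \<open>p\<close>.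
\<close>

section \<open>Even words in the involutions\<close>

text \<open>\<open>has_derivative\<close> alone provides a real-linear map; the homogeneity clause
  makes it complex linear.\<close>

definition complex_derivative_at :: "(complex^3 \<Rightarrow> complex^3) \<Rightarrow> (complex^3 \<Rightarrow> complex^3) \<Rightarrow> complex^3 \<Rightarrow> bool" where
  "complex_derivative_at f L p \<longleftrightarrow> (f has_derivative L) (at p) \<and> (\<forall>c v. L (c *s v) = c *s L v)"

text \<open>The second clause lets one-variable function theory be applied along holomorphic curves.
  Both clauses are stable under composition.\<close>

definition holomorphic_map :: "(complex^3 \<Rightarrow> complex^3) \<Rightarrow> bool" where
  "holomorphic_map f \<longleftrightarrow> (\<forall>p. \<exists>L. complex_derivative_at f L p) \<and>
     (\<forall>c T. (\<forall>i. (\<lambda>t. c t $ i) holomorphic_on T) \<longrightarrow> (\<forall>i. (\<lambda>t. f (c t) $ i) holomorphic_on T))"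

lemma complex_derivative_at_id: "complex_derivative_at id id p"
  by (simp add: complex_derivative_at_def)

lemma complex_derivative_at_comp:
  assumes "complex_derivative_at g M (f p)" "complex_derivative_at f L p"
  shows "complex_derivative_at (g \<circ> f) (M \<circ> L) p"
  using assms diff_chain_at[of f L p g M] by (auto simp: complex_derivative_at_def)

lemma complex_derivative_at_unique:
  assumes "complex_derivative_at f L p" "complex_derivative_at f M p"
  shows "L = M"
  using assms has_derivative_unique unfolding complex_derivative_at_def by blast

lemma complex_derivative_at_linear:
  assumes "complex_derivative_at f L p"
  shows "L (v - w) = L v - L w" "L (v + w) = L v + L w" "L (c *s v) = c *s L v" "L 0 = 0"
  using assms
  by (auto simp: complex_derivative_at_def has_derivative_def linear_diff linear_add linear_0 dest!: bounded_linear.linear)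

lemma complex_derivative_at_funpow:
  assumes "complex_derivative_at f L p" "f p = p"
  shows "complex_derivative_at (f ^^ n) (L ^^ n) p"
proof (induction n)
  case 0
  then show ?case using complex_derivative_at_id by (simp add: id_def)
next
  case (Suc n)
  have "(f ^^ n) p = p"
    using assms(2) by (induction n) auto
  then show ?case
    using complex_derivative_at_comp[OF _ Suc, of f L] assms by (simp add: comp_def)
qed

lemma holomorphic_map_derivative:
  assumes "holomorphic_map f"
  obtains L where "complex_derivative_at f L p"
  using assms unfolding holomorphic_map_def by blast

lemma holomorphic_map_holomorphic:
  assumes "holomorphic_map f" "\<And>i. (\<lambda>t. c t $ i) holomorphic_on T"
  shows "(\<lambda>t. f (c t) $ i) holomorphic_on T"
  using assms unfolding holomorphic_map_def by simp

lemma holomorphic_map_id: "holomorphic_map id"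
  using complex_derivative_at_id by (auto simp: holomorphic_map_def)

lemma holomorphic_map_comp:
  assumes "holomorphic_map f" "holomorphic_map g"
  shows "holomorphic_map (f \<circ> g)"
  using assms complex_derivative_at_comp unfolding holomorphic_map_def comp_def by metis

lemma holomorphic_map_continuous:
  assumes "holomorphic_map f" shows "continuous_on UNIV f"
  using assms unfolding holomorphic_map_def complex_derivative_at_def
  by (meson has_derivative_at_withinI has_derivative_continuous_on iso_tuple_UNIV_I)

lemma has_derivative_vector_3:
  fixes f g h :: "'a::real_normed_vector \<Rightarrow> complex"
  assumes "(f has_derivative f') F" "(g has_derivative g') F" "(h has_derivative h') F"
  shows "((\<lambda>x. vector [f x, g x, h x] :: complex^3) has_derivative (\<lambda>x. vector [f' x, g' x, h' x])) F"
proof -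
  have eq: "(vector [a, b, c] :: complex^3) = axis 1 a + axis 2 b + axis 3 c" for a b c
    by (simp add: vec_eq_iff forall_3 axis_def)
  have bl: "bounded_linear (axis i :: complex \<Rightarrow> complex^3)" for i
    by (intro linear_conv_bounded_linear[THEN iffD1] linearI) (auto simp: axis_def vec_eq_iff)
  show ?thesis
    unfolding eq
    by (intro has_derivative_add bounded_linear.has_derivative[OF bl] assms)
qed

lemma has_derivative_component:
  "((\<lambda>p::complex^3. p $ i) has_derivative (\<lambda>v. v $ i)) F"
  by (rule bounded_linear_imp_has_derivative) (rule bounded_linear_vec_nth)

lemma holomorphic_map_vector:
  assumes "\<And>p. (f1 has_derivative d1 p) (at p)" "\<And>p. (f2 has_derivative d2 p) (at p)"
    "\<And>p. (f3 has_derivative d3 p) (at p)"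
    "\<And>p c v. d1 p (c *s v) = c * d1 p v" "\<And>p c v. d2 p (c *s v) = c * d2 p v"
    "\<And>p c v. d3 p (c *s v) = c * d3 p v"
    "\<And>c T. (\<forall>i. (\<lambda>t. c t $ i) holomorphic_on T) \<Longrightarrow> (\<lambda>t. f1 (c t)) holomorphic_on T"
    "\<And>c T. (\<forall>i. (\<lambda>t. c t $ i) holomorphic_on T) \<Longrightarrow> (\<lambda>t. f2 (c t)) holomorphic_on T"
    "\<And>c T. (\<forall>i. (\<lambda>t. c t $ i) holomorphic_on T) \<Longrightarrow> (\<lambda>t. f3 (c t)) holomorphic_on T"
  shows "holomorphic_map (\<lambda>p. vector [f1 p, f2 p, f3 p])"
proof -
  have "complex_derivative_at (\<lambda>p. vector [f1 p, f2 p, f3 p]) (\<lambda>v. vector [d1 p v, d2 p v, d3 p v]) p" for p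
    using has_derivative_vector_3[OF assms(1-3), of p] assms(4-6)
    by (auto simp: complex_derivative_at_def vec_eq_iff forall_3)
  then show ?thesis
    using assms(7-9) unfolding holomorphic_map_def by (auto simp: forall_3)
qed

lemma holomorphic_map_inv_x: "holomorphic_map (inv_x A)"
  unfolding inv_x_def
  by (rule holomorphic_map_vector)
    (rule has_derivative_component derivative_eq_intros refl holomorphic_intros | simp add: algebra_simps)+

lemma holomorphic_map_inv_y: "holomorphic_map (inv_y A)"
  unfolding inv_y_def
  by (rule holomorphic_map_vector)
    (rule has_derivative_component derivative_eq_intros refl holomorphic_intros | simp add: algebra_simps)+

lemma holomorphic_map_inv_z: "holomorphic_map (inv_z A)"
  unfolding inv_z_def
  by (rule holomorphic_map_vector)
    (rule has_derivative_component derivative_eq_intros refl holomorphic_intros | simp add: algebra_simps)+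

definition involutions :: "complex \<Rightarrow> complex \<Rightarrow> complex \<Rightarrow> (complex^3 \<Rightarrow> complex^3) set" where
  "involutions A B C = {inv_x A, inv_y B, inv_z C}"

inductive_set even_words :: "complex \<Rightarrow> complex \<Rightarrow> complex \<Rightarrow> (complex^3 \<Rightarrow> complex^3) set"
  for A B C where
  id_word: "id \<in> even_words A B C"
| step_word: "\<lbrakk>f \<in> involutions A B C; g \<in> involutions A B C; w \<in> even_words A B C\<rbrakk>
    \<Longrightarrow> f \<circ> g \<circ> w \<in> even_words A B C"

lemma even_words_pair:
  "\<lbrakk>f \<in> involutions A B C; g \<in> involutions A B C\<rbrakk> \<Longrightarrow> f \<circ> g \<in> even_words A B C"
  using step_word[OF _ _ id_word] by simp

lemma even_words_comp:
  assumes "v \<in> even_words A B C" "w \<in> even_words A B C"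
  shows "v \<circ> w \<in> even_words A B C"
  using assms by induction (auto simp: comp_assoc intro: step_word[unfolded comp_assoc])

lemma even_words_funpow:
  assumes "w \<in> even_words A B C"
  shows "w ^^ n \<in> even_words A B C"
  using assms by (induction n) (auto intro: id_word[unfolded id_def] even_words_comp simp: id_def)

lemma involutions_holomorphic_map: "f \<in> involutions A B C \<Longrightarrow> holomorphic_map f"
  by (auto simp: involutions_def holomorphic_map_inv_x holomorphic_map_inv_y holomorphic_map_inv_z)

lemma involutions_comp_self: "f \<in> involutions A B C \<Longrightarrow> f \<circ> f = id"
  by (auto simp: involutions_def involutions_involutive fun_eq_iff)

lemma surface_poly_involutions:
  "f \<in> involutions A B C \<Longrightarrow> surface_poly A B C D (f p) = surface_poly A B C D p"
  by (auto simp: involutions_def surface_poly_def inv_x_def inv_y_def inv_z_def power2_eq_square algebra_simps)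

lemma even_words_holomorphic_map: "w \<in> even_words A B C \<Longrightarrow> holomorphic_map w"
  by (induction rule: even_words.induct)
    (simp_all only: holomorphic_map_id holomorphic_map_comp involutions_holomorphic_map)

lemma surface_poly_even_words:
  "w \<in> even_words A B C \<Longrightarrow> surface_poly A B C D (w p) = surface_poly A B C D p"
  by (induction arbitrary: p rule: even_words.induct) (auto simp: surface_poly_involutions)

lemma even_words_surface:
  "w \<in> even_words A B C \<Longrightarrow> w p \<in> surface A B C D \<longleftrightarrow> p \<in> surface A B C D"
  by (simp add: surface_eq_zero_set surface_poly_even_words)

lemma even_words_inverse:
  assumes "w \<in> even_words A B C"
  obtains w' where "w' \<in> even_words A B C" "w \<circ> w' = id" "w' \<circ> w = id"
  using assms
proof (induction arbitrary: thesis)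
  case id_word
  show ?case by (rule id_word[OF even_words.id_word]) auto
next
  case (step_word f g w)
  obtain w' where w': "w' \<in> even_words A B C" "w \<circ> w' = id" "w' \<circ> w = id"
    using step_word.IH by blast
  have inv: "f (f p) = p" "g (g p) = p" "w (w' p) = p" "w' (w p) = p" for p
    using involutions_comp_self[OF step_word.hyps(1)] involutions_comp_self[OF step_word.hyps(2)] w'
    by (simp_all add: fun_eq_iff)
  have "w' \<circ> (g \<circ> f) \<in> even_words A B C"
    by (intro even_words_comp even_words_pair step_word.hyps w')
  then show ?case
    by (rule step_word.prems) (auto simp: fun_eq_iff inv)
qed

section \<open>The surface group as the restrictions of even words\<close>

lemma carrier_BijGroup: "carrier (BijGroup S) = Bij S"
  by (simp add: BijGroup_def)

lemma restrict_even_words_Bij: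
  assumes "w \<in> even_words A B C"
  shows "restrict w (surface A B C D) \<in> Bij (surface A B C D)"
proof -
  obtain w' where w': "w' \<in> even_words A B C" "w \<circ> w' = id" "w' \<circ> w = id"
    using even_words_inverse[OF assms] .
  have "bij_betw w (surface A B C D) (surface A B C D)"
    by (rule bij_betwI[where g = w'])
      (use w' assms in \<open>auto simp: even_words_surface fun_eq_iff\<close>)
  then show ?thesis
    by (simp add: Bij_def cong: bij_betw_cong)
qed

lemma mult_BijGroup_even_words:
  fixes D :: complex
  assumes "v \<in> even_words A B C" "w \<in> even_words A B C"
  defines "S \<equiv> surface A B C D"
  shows "restrict v S \<otimes>\<^bsub>BijGroup S\<^esub> restrict w S = restrict (v \<circ> w) S"
  using assms restrict_even_words_Bij[of v A B C D] restrict_even_words_Bij[of w A B C D]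
  by (auto simp: BijGroup_def compose_def fun_eq_iff even_words_surface)

lemma one_BijGroup: "\<one>\<^bsub>BijGroup S\<^esub> = restrict id S"
  by (auto simp: BijGroup_def)

lemma inv_BijGroup_even_words:
  fixes D :: complex
  assumes "v \<in> even_words A B C" "w \<in> even_words A B C" "w \<circ> v = id"
  defines "S \<equiv> surface A B C D"
  shows "m_inv (BijGroup S) (restrict v S) = restrict w S"
proof (rule group.inv_equality[OF group_BijGroup])
  show "restrict w S \<otimes>\<^bsub>BijGroup S\<^esub> restrict v S = \<one>\<^bsub>BijGroup S\<^esub>"
    using mult_BijGroup_even_words[OF assms(2,1)] assms(3) by (simp add: S_def one_BijGroup)
qed (use restrict_even_words_Bij assms in \<open>auto simp: carrier_BijGroup\<close>)

lemma surface_generators_eq: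
  "surface_generators A B C D = (\<lambda>w. restrict w (surface A B C D)) ` {inv_z C \<circ> inv_y B, inv_x A \<circ> inv_z C, inv_y B \<circ> inv_x A}"
  by (auto simp: surface_generators_def)

lemma restrict_pair_surface_group:
  assumes "f \<in> involutions A B C" "g \<in> involutions A B C"
  shows "restrict (f \<circ> g) (surface A B C D) \<in> surface_group A B C D"
proof -
  let ?S = "surface A B C D"
  let ?gens = "{inv_z C \<circ> inv_y B, inv_x A \<circ> inv_z C, inv_y B \<circ> inv_x A}"
  have fg: "f \<circ> g \<in> even_words A B C" "g \<circ> f \<in> even_words A B C"
    using assms even_words_pair by auto
  have id: "(g \<circ> f) \<circ> (f \<circ> g) = id" "(f \<circ> g) \<circ> (g \<circ> f) = id"
    using involutions_comp_self[OF assms(1)] involutions_comp_self[OF assms(2)]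
    by (auto simp: fun_eq_iff)
  \<comment> \<open>Of the nine ordered pairs, three cancel, three are generators and three are
    inverses of generators.\<close>
  consider "f = g" | "f \<circ> g \<in> ?gens" | "g \<circ> f \<in> ?gens"
    using assms by (auto simp: involutions_def)
  then show ?thesis
  proof cases
    case 1
    then show ?thesis
      using involutions_comp_self[OF assms(1)] generate.one[of "BijGroup ?S"]
      by (simp add: surface_group_def one_BijGroup)
  next
    case 2
    then show ?thesis
      unfolding surface_group_def surface_generators_eq by (intro generate.incl) blast
  next
    case 3
    then have "m_inv (BijGroup ?S) (restrict (g \<circ> f) ?S) \<in> surface_group A B C D"
      unfolding surface_group_def surface_generators_eq by (intro generate.inv) blast
    then show ?thesis
      by (simp add: inv_BijGroup_even_words[OF fg(2,1) id(2)])
  qed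
qed

text \<open>This replaces the abstract generated group by explicit polynomial maps. Even words
  contain the generators and are closed under products and inverses; conversely, each pair of
  involutions restricts to a group element.\<close>

lemma surface_group_eq:
  "surface_group A B C D = (\<lambda>w. restrict w (surface A B C D)) ` even_words A B C"
proof (intro equalityI subsetI)
  let ?S = "surface A B C D"
  have gens: "\<exists>w\<in>even_words A B C. h = restrict w ?S" if "h \<in> surface_generators A B C D" for h
  proof -
    have "inv_z C \<circ> inv_y B \<in> even_words A B C" "inv_x A \<circ> inv_z C \<in> even_words A B C"
      "inv_y B \<circ> inv_x A \<in> even_words A B C"
      by (auto simp: involutions_def intro!: even_words_pair)
    then show ?thesis
      using that unfolding surface_generators_eq by blast
  qed
  fix h assume "h \<in> surface_group A B C D"
  then show "h \<in> (\<lambda>w. restrict w ?S) ` even_words A B C"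
    unfolding surface_group_def
  proof induction
    case one
    show ?case
      unfolding one_BijGroup using id_word by (rule imageI)
  next
    case (incl h)
    then show ?case using gens by blast
  next
    case (inv h)
    then obtain w where w: "w \<in> even_words A B C" "h = restrict w ?S" using gens by blast
    obtain w' where w': "w' \<in> even_words A B C" "w' \<circ> w = id"
      using even_words_inverse[OF w(1)] .
    show ?case
      unfolding w(2) inv_BijGroup_even_words[OF w(1) w'] using w'(1) by (rule imageI)
  next
    case (eng h1 h2)
    then obtain v w where vw: "v \<in> even_words A B C" "h1 = restrict v ?S"
      "w \<in> even_words A B C" "h2 = restrict w ?S"
      by blast
    show ?case
      unfolding vw(2,4) mult_BijGroup_even_words[OF vw(1,3)]
      using even_words_comp[OF vw(1,3)] by (rule imageI)
  qed
next
  let ?S = "surface A B C D"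
  fix h assume "h \<in> (\<lambda>w. restrict w ?S) ` even_words A B C"
  then obtain w where w: "w \<in> even_words A B C" "h = restrict w ?S" by blast
  from w(1) have "restrict w ?S \<in> surface_group A B C D"
  proof induction
    case id_word
    then show ?case
      using generate.one[of "BijGroup ?S"] unfolding surface_group_def one_BijGroup by blast
  next
    case (step_word f g w)
    have "restrict (f \<circ> g) ?S \<otimes>\<^bsub>BijGroup ?S\<^esub> restrict w ?S \<in> surface_group A B C D"
      using step_word.IH restrict_pair_surface_group[OF step_word.hyps(1,2), of D]
      unfolding surface_group_def by (intro generate.eng)
    then show ?case
      unfolding mult_BijGroup_even_words[OF even_words_pair[OF step_word.hyps(1,2)] step_word.hyps(3)] .
  qed
  then show "h \<in> surface_group A B C D" using w by simp
qed

section \<open>Parabolic fixed points\<close>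

lemma tangent_plane_eq:
  "tangent_plane A B C p = {v. surface_grad A B C p $ 1 * v $ 1 + surface_grad A B C p $ 2 * v $ 2
      + surface_grad A B C p $ 3 * v $ 3 = 0}"
  by (simp add: tangent_plane_def sum_3)

lemma subspace_tangent_plane: "vec.subspace (tangent_plane A B C q)"
  by (simp add: vec.subspace_def tangent_plane_def distrib_left sum.distrib mult.left_commute
      sum_distrib_left[symmetric])

text \<open>By the chain rule, the gradient functional at \<open>f p\<close> pulled back along
  \<open>L\<close> is the gradient functional at \<open>p\<close>.\<close>

lemma tangent_plane_image:
  assumes "complex_derivative_at f L p"
    and "\<And>q. surface_poly A' B' C' D' (f q) = surface_poly A B C D q"
  shows "L v \<in> tangent_plane A' B' C' (f p) \<longleftrightarrow> v \<in> tangent_plane A B C p"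
proof -
  let ?d = "\<lambda>v. \<Sum>i\<in>UNIV. surface_grad A B C p $ i * v $ i"
  let ?d' = "\<lambda>v. \<Sum>i\<in>UNIV. surface_grad A' B' C' (f p) $ i * v $ i"
  have "((\<lambda>q. surface_poly A' B' C' D' (f q)) has_derivative (\<lambda>v. ?d' (L v))) (at p)"
    using has_derivative_compose[OF _ surface_poly_has_derivative] assms(1)
    unfolding complex_derivative_at_def by blast
  then have "(surface_poly A B C D has_derivative (\<lambda>v. ?d' (L v))) (at p)"
    by (simp add: assms(2))
  then have "(\<lambda>v. ?d' (L v)) = ?d"
    using has_derivative_unique surface_poly_has_derivative by blast
  then show ?thesis
    unfolding tangent_plane_def mem_Collect_eq by metis
qed

text \<open>With \<open>N = L - id\<close> the last two conditions read
  \<open>N \<xi> \<noteq> 0\<close> and \<open>N (N \<xi>) = 0\<close>: a nontrivial Jordan block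
  for the eigenvalue 1, expressed by a single tangent vector.\<close>

definition parabolic_point ::
    "complex \<Rightarrow> complex \<Rightarrow> complex \<Rightarrow> complex \<Rightarrow> (complex^3 \<Rightarrow> complex^3) \<Rightarrow> complex^3 \<Rightarrow> bool" where
  "parabolic_point A B C D w q \<longleftrightarrow>
     smooth_point A B C D q \<and> w \<in> even_words A B C \<and> w q = q \<and>
     (\<exists>L \<xi>. complex_derivative_at w L q \<and> \<xi> \<in> tangent_plane A B C q \<and>
        L \<xi> \<noteq> \<xi> \<and> L (L \<xi> - \<xi>) = L \<xi> - \<xi>)"

definition parabolic_points :: "complex \<Rightarrow> complex \<Rightarrow> complex \<Rightarrow> complex \<Rightarrow> (complex^3) set" where
  "parabolic_points A B C D = {q. \<exists>w. parabolic_point A B C D w q}"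

lemma tangent_plane_UNIV:
  assumes "tangent_plane A B C q = UNIV" shows "surface_grad A B C q = 0"
proof -
  have "(axis i 1 :: complex^3) \<in> tangent_plane A B C q" for i
    using assms by auto
  from this[of 1] this[of 2] this[of 3] show ?thesis
    by (simp add: tangent_plane_eq vec_eq_iff forall_3 axis_def)
qed

text \<open>In this form smoothness is transported by the derivative of an invertible map.\<close>

lemma smooth_point_iff_tangent_plane:
  "smooth_point A B C D q \<longleftrightarrow> q \<in> surface A B C D \<and> tangent_plane A B C q \<noteq> UNIV"
  using tangent_plane_UNIV by (auto simp: smooth_point_def tangent_plane_def)

text \<open>Conjugation by \<open>h\<close> turns the fixed point \<open>q\<close>, the derivative
  \<open>L\<close> and the vector \<open>\<xi>\<close> into \<open>h q\<close>,
  \<open>H \<circ> L \<circ> H'\<close> and \<open>H \<xi>\<close>. It serves both for group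
  elements and for permutations of the coordinates.\<close>

lemma parabolic_points_transfer:
  assumes q: "q \<in> parabolic_points A B C D"
    and h: "h \<circ> h' = id" "h' \<circ> h = id"
    and poly: "\<And>p. surface_poly A' B' C' D' (h p) = surface_poly A B C D p"
    and like: "holomorphic_map h" "holomorphic_map h'"
    and conj: "\<And>w. w \<in> even_words A B C \<Longrightarrow> h \<circ> w \<circ> h' \<in> even_words A' B' C'"
  shows "h q \<in> parabolic_points A' B' C' D'"
proof -
  have hh: "h (h' p) = p" "h' (h p) = p" for p
    using h by (simp_all add: fun_eq_iff)
  obtain w L \<xi> where w: "smooth_point A B C D q" "w \<in> even_words A B C" "w q = q"
    "complex_derivative_at w L q" "\<xi> \<in> tangent_plane A B C q" "L \<xi> \<noteq> \<xi>" "L (L \<xi> - \<xi>) = L \<xi> - \<xi>"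
    using q by (auto simp: parabolic_points_def parabolic_point_def)
  obtain H where H: "complex_derivative_at h H q"
    using holomorphic_map_derivative[OF like(1)] .
  obtain H' where H': "complex_derivative_at h' H' (h q)"
    using holomorphic_map_derivative[OF like(2)] .
  have "complex_derivative_at (h' \<circ> h) (H' \<circ> H) q"
    using complex_derivative_at_comp[OF H' H] .
  then have H'H: "H' (H v) = v" for v
    using complex_derivative_at_unique[OF _ complex_derivative_at_id] h(2) by (metis comp_apply id_apply)
  have "complex_derivative_at (h \<circ> h') (H \<circ> H') (h q)"
    using complex_derivative_at_comp[OF _ H', of h H] H hh by simp
  then have HH': "H (H' v) = v" for v
    using complex_derivative_at_unique[OF _ complex_derivative_at_id] h(1) by (metis comp_apply id_apply)
  have tan: "H v \<in> tangent_plane A' B' C' (h q) \<longleftrightarrow> v \<in> tangent_plane A B C q" for v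
    by (rule tangent_plane_image[OF H poly])
  have "complex_derivative_at (h \<circ> w \<circ> h') (H \<circ> L \<circ> H') (h q)"
    using H H' w(3,4) by (intro complex_derivative_at_comp) (simp_all add: hh)
  moreover have "smooth_point A' B' C' D' (h q)"
    using w(1) tan HH' poly[of q] unfolding smooth_point_iff_tangent_plane surface_eq_zero_set by auto
  moreover have "(H \<circ> L \<circ> H') (H \<xi>) - H \<xi> = H (L \<xi> - \<xi>)"
    by (simp add: complex_derivative_at_linear[OF H] H'H)
  moreover have "H (L \<xi> - \<xi>) \<noteq> 0"
    using H'H[of "L \<xi> - \<xi>"] w(6) complex_derivative_at_linear(4)[OF H'] by auto
  ultimately have "parabolic_point A' B' C' D' (h \<circ> w \<circ> h') (h q)"
    unfolding parabolic_point_def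
    using w(2,3,5,7) conj tan hh H'H
    by (intro conjI exI[of _ "H \<circ> L \<circ> H'"] exI[of _ "H \<xi>"]) auto
  then show ?thesis
    by (auto simp: parabolic_points_def)
qed

lemma parabolic_points_even_words:
  assumes "w \<in> even_words A B C" "w q \<in> parabolic_points A B C D"
  shows "q \<in> parabolic_points A B C D"
proof -
  obtain w' where w': "w' \<in> even_words A B C" "w \<circ> w' = id" "w' \<circ> w = id"
    using even_words_inverse[OF assms(1)] .
  have "w' (w q) \<in> parabolic_points A B C D"
    by (rule parabolic_points_transfer[OF assms(2) w'(3,2)])
      (use w' assms in \<open>auto simp: surface_poly_even_words even_words_holomorphic_map intro!: even_words_comp\<close>)
  then show ?thesis
    using w'(3) by (simp add: fun_eq_iff)
qed

lemma parabolic_points_even_words_iff: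
  assumes "w \<in> even_words A B C"
  shows "w q \<in> parabolic_points A B C D \<longleftrightarrow> q \<in> parabolic_points A B C D"
proof -
  obtain w' where w': "w' \<in> even_words A B C" "w' \<circ> w = id"
    using even_words_inverse[OF assms] .
  then have "w' (w q) = q"
    by (simp add: fun_eq_iff)
  then show ?thesis
    using parabolic_points_even_words[OF assms] parabolic_points_even_words[OF w'(1), of "w q"] by auto
qed

section \<open>Cyclic permutation of the coordinates and of the parameters\<close>

definition rot :: "complex^3 \<Rightarrow> complex^3" where
  "rot p = vector [p $ 2, p $ 3, p $ 1]"

definition unrot :: "complex^3 \<Rightarrow> complex^3" where
  "unrot p = vector [p $ 3, p $ 1, p $ 2]"

lemma rot_unrot [simp]: "rot (unrot p) = p" "unrot (rot p) = p"
  by (simp_all add: rot_def unrot_def vec_eq_iff forall_3)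

lemma rot_nth [simp]: "rot p $ 1 = p $ 2" "rot p $ 2 = p $ 3" "rot p $ 3 = p $ 1"
  by (simp_all add: rot_def)

lemma unrot_nth [simp]: "unrot p $ 1 = p $ 3" "unrot p $ 2 = p $ 1" "unrot p $ 3 = p $ 2"
  by (simp_all add: unrot_def)

lemma surface_poly_rot: "surface_poly B C A D (rot p) = surface_poly A B C D p"
  by (simp add: surface_poly_def algebra_simps)

lemma surface_rot: "rot p \<in> surface B C A D \<longleftrightarrow> p \<in> surface A B C D"
  by (simp add: surface_eq_zero_set surface_poly_rot)

lemma surface_grad_rot: "surface_grad B C A (rot p) = rot (surface_grad A B C p)"
  by (simp add: surface_grad_def vec_eq_iff forall_3 algebra_simps)

lemma tangent_plane_rot: "rot v \<in> tangent_plane B C A (rot p) \<longleftrightarrow> v \<in> tangent_plane A B C p"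
  by (simp add: tangent_plane_eq surface_grad_rot algebra_simps)

lemma holomorphic_map_rot: "holomorphic_map rot"
  unfolding rot_def
  by (rule holomorphic_map_vector) (rule has_derivative_component refl | simp)+

lemma holomorphic_map_unrot: "holomorphic_map unrot"
  unfolding unrot_def
  by (rule holomorphic_map_vector) (rule has_derivative_component refl | simp)+

lemma involutions_rot:
  assumes "f \<in> involutions A B C" shows "rot \<circ> f \<circ> unrot \<in> involutions B C A"
proof -
  have "rot \<circ> inv_x A \<circ> unrot = inv_z A" "rot \<circ> inv_y B \<circ> unrot = inv_x B" "rot \<circ> inv_z C \<circ> unrot = inv_y C"
    by (simp_all add: fun_eq_iff inv_x_def inv_y_def inv_z_def vec_eq_iff forall_3 algebra_simps)
  then show ?thesis
    using assms by (auto simp: involutions_def)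
qed

lemma even_words_rot: "w \<in> even_words A B C \<Longrightarrow> rot \<circ> w \<circ> unrot \<in> even_words B C A"
proof (induction rule: even_words.induct)
  case id_word
  have "rot \<circ> id \<circ> unrot = id" by (simp add: fun_eq_iff)
  then show ?case by (simp only: even_words.id_word)
next
  case (step_word f g w)
  have "rot \<circ> (f \<circ> g \<circ> w) \<circ> unrot = (rot \<circ> f \<circ> unrot) \<circ> (rot \<circ> g \<circ> unrot) \<circ> (rot \<circ> w \<circ> unrot)"
    by (simp add: fun_eq_iff)
  then show ?case
    using even_words.step_word[OF involutions_rot[OF step_word.hyps(1)] involutions_rot[OF step_word.hyps(2)] step_word.IH]
    by (simp only:)
qed

text \<open>Reduces claims about the second and third coordinates to the first.\<close>

lemma parabolic_points_rot:
  assumes "q \<in> parabolic_points A B C D" shows "rot q \<in> parabolic_points B C A D"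
  by (rule parabolic_points_transfer[OF assms, where h' = unrot])
    (auto simp: fun_eq_iff surface_poly_rot holomorphic_map_rot holomorphic_map_unrot even_words_rot)

section \<open>The action on the fibres of the first coordinate\<close>

definition gx :: "complex \<Rightarrow> complex \<Rightarrow> complex^3 \<Rightarrow> complex^3" where
  "gx B C = inv_z C \<circ> inv_y B"

lemma gx_nth:
  "gx B C p $ 1 = p $ 1" "gx B C p $ 2 = - p $ 2 - p $ 1 * p $ 3 + B"
  "gx B C p $ 3 = - p $ 3 - p $ 1 * gx B C p $ 2 + C"
  by (simp_all add: gx_def inv_z_def inv_y_def)

lemma gx_even_words: "gx B C \<in> even_words A B C"
  unfolding gx_def by (rule even_words_pair) (simp_all add: involutions_def)

text \<open>On the fibre over \<open>x = - (l + 1/l)\<close> the following functional spans an eigenline of the affine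
  map \<open>g\<^sub>x\<close>; \<open>l\<close> and \<open>1/l\<close> give the two eigenlines.\<close>

definition fibre_functional :: "complex \<Rightarrow> complex \<Rightarrow> complex \<Rightarrow> complex^3 \<Rightarrow> complex" where
  "fibre_functional B C l p = (2 * p$3 + p$1 * p$2 - C) + l * (2 * p$2 + p$1 * p$3 - B)"

lemma fibre_functional_eq:
  "fibre_functional B C l p = surface_grad A B C p $ 3 + l * surface_grad A B C p $ 2"
  by (simp add: fibre_functional_def surface_grad_def)

text \<open>The functional is built from the two gradient entries that vanish at the centre of the
  fibre conic; hence it is scaled without an additive constant.\<close>

lemma fibre_functional_gx:
  assumes "p $ 1 = - (l + 1 / l)" "l \<noteq> 0"
  shows "fibre_functional B C l (gx B C p) = l\<^sup>2 * fibre_functional B C l p"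
proof -
  \<comment> \<open>Treating \<open>1 / l\<close> as a variable \<open>k\<close> with
    \<open>k * l = 1\<close> leaves a polynomial identity.\<close>
  define k where "k = 1 / l"
  have k: "k * l = 1" "p $ 1 = - (l + k)"
    using assms by (simp_all add: k_def)
  show ?thesis
    using k(1) by (simp add: fibre_functional_def gx_nth k(2)) algebra
qed

lemma gx_funpow_nth_1: "(gx B C ^^ n) p $ 1 = p $ 1"
  by (induction n) (simp_all add: gx_nth)

lemma fibre_functional_gx_funpow:
  assumes "p $ 1 = - (l + 1 / l)" "l \<noteq> 0"
  shows "fibre_functional B C l ((gx B C ^^ n) p) = l ^ (2 * n) * fibre_functional B C l p"
proof (induction n)
  case (Suc n)
  have "fibre_functional B C l ((gx B C ^^ Suc n) p)
      = l\<^sup>2 * fibre_functional B C l ((gx B C ^^ n) p)"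
    using fibre_functional_gx[of "(gx B C ^^ n) p"] assms by (simp add: gx_funpow_nth_1)
  then show ?case
    using Suc by (simp add: power_add power2_eq_square)
qed simp

lemma fibre_functional_both_0:
  assumes "fibre_functional B C l p = 0" "fibre_functional B C (1 / l) p = 0" "l \<noteq> 0" "l\<^sup>2 \<noteq> 1"
  shows "surface_grad A B C p $ 2 = 0" "surface_grad A B C p $ 3 = 0"
proof -
  have "(l - 1 / l) * surface_grad A B C p $ 2 = 0"
    using assms(1,2) unfolding fibre_functional_eq[where A = A] by algebra
  moreover have "l - 1 / l \<noteq> 0"
    using assms(3,4) by (simp add: field_simps power2_eq_square)
  ultimately show *: "surface_grad A B C p $ 2 = 0"
    by simp
  show "surface_grad A B C p $ 3 = 0"
    using assms(1) * by (simp add: fibre_functional_eq[where A = A])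
qed

text \<open>Both eigenvalues of the iterate, \<open>l ^ (2 * n)\<close> and its inverse, are 1, so
  both functionals agree at a point and its image; for \<open>l\<^sup>2 \<noteq> 1\<close> they
  separate the points of a fibre.\<close>

lemma gx_funpow_fixes_fibre:
  assumes "p $ 1 = - (l + 1 / l)" "l \<noteq> 0" "l\<^sup>2 \<noteq> 1" "l ^ (2 * n) = 1"
  shows "(gx B C ^^ n) p = p"
proof -
  define q where "q = (gx B C ^^ n) p"
  have q1: "q $ 1 = p $ 1"
    by (simp add: q_def gx_funpow_nth_1)
  have e1: "fibre_functional B C l q = fibre_functional B C l p"
    using fibre_functional_gx_funpow[OF assms(1,2)] assms(4) by (simp add: q_def)
  have e2: "fibre_functional B C (1 / l) q = fibre_functional B C (1 / l) p"
    using fibre_functional_gx_funpow[of p "1 / l" B C n] assms by (simp add: q_def power_one_over add.commute)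
  \<comment> \<open>\<open>u\<close> keeps the first coordinate of \<open>p\<close> but has the
    differences of the other two, so the functionals with \<open>B = C = 0\<close> vanish at
    it.\<close>
  define u where "u = q - p + vector [p $ 1, 0, 0]"
  have "fibre_functional 0 0 l u = 0" "fibre_functional 0 0 (1 / l) u = 0"
    using e1 e2 by (simp_all add: fibre_functional_def u_def q1 algebra_simps)
  from fibre_functional_both_0[OF this assms(2,3), of 0]
  have u: "2 * u $ 2 + p $ 1 * u $ 3 = 0" "2 * u $ 3 + p $ 1 * u $ 2 = 0"
    by (simp_all add: surface_grad_def u_def q1)
  \<comment> \<open>This is the determinant of the linear system for \<open>u\<close>; it is nonzero
    because \<open>l\<close> is not its own inverse.\<close>
  have "4 - (p $ 1)\<^sup>2 = - (l - 1 / l)\<^sup>2"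
    unfolding assms(1) using assms(2) by (simp add: power2_eq_square field_simps)
  moreover have "l - 1 / l \<noteq> 0"
    using assms(2,3) by (simp add: field_simps power2_eq_square)
  ultimately have "4 - (p $ 1)\<^sup>2 \<noteq> 0"
    by simp
  moreover have "(4 - (p $ 1)\<^sup>2) * u $ 2 = 0" "(4 - (p $ 1)\<^sup>2) * u $ 3 = 0"
    using u by algebra+
  ultimately have "u $ 2 = 0" "u $ 3 = 0"
    by auto
  then show ?thesis
    using q1 by (simp add: u_def q_def vec_eq_iff forall_3)
qed

text \<open>The idea is to let the eigenvalue parameter \<open>m\<close> vary in the scaling law of
  the functional under the iterate and to differentiate at \<open>m = l\<close>. If \<open>L\<close>
  fixes the direction transverse to the fibres, the two sides differ only by the derivative of the
  factor \<open>m ^ (2 * n)\<close> times the functional at \<open>q\<close>, which must therefore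
  vanish.\<close>

lemma fibre_functional_0_if_derivative_id:
  assumes L: "complex_derivative_at (gx B C ^^ n) L q" "L (axis 1 1) = axis 1 1"
    and q: "q $ 1 = - (l + 1 / l)" "l \<noteq> 0" "(gx B C ^^ n) q = q" "n > 0"
  shows "fibre_functional B C l q = 0"
proof -
  let ?w = "gx B C ^^ n"
  define x where "x = (\<lambda>m. - (m + 1 / m) :: complex)"
  define x' where "x' = - (1 - 1 / l\<^sup>2)"
  \<comment> \<open>A curve through \<open>q\<close> that moves only the first coordinate,
    parametrised by \<open>m\<close>.\<close>
  define P :: "complex \<Rightarrow> complex^3" where "P = (\<lambda>m. vector [x m, q $ 2, q $ 3])"
  have x: "(x has_field_derivative x') (at l)"
    unfolding x_def x'_def
    by (auto intro!: derivative_eq_intros simp: q(2) power2_eq_square field_simps)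
  have Pl: "P l = q"
    using q(1) by (simp add: P_def x_def vec_eq_iff forall_3)
  have xl: "x l = q $ 1"
    using q(1) by (simp add: x_def)
  have P: "(P has_derivative (\<lambda>t. vector [x' * t, 0, 0])) (at l)"
    unfolding P_def
    using x by (intro has_derivative_vector_3) (auto simp: has_field_derivative_def)
  have "((\<lambda>m. ?w (P m)) has_derivative (\<lambda>t. L (vector [x' * t, 0, 0]))) (at l)"
    using has_derivative_compose[OF P] L(1) Pl unfolding complex_derivative_at_def by blast
  moreover have "L (vector [x' * t, 0, 0]) = (x' * t) *s axis 1 1" for t
  proof -
    have "(vector [x' * t, 0, 0] :: complex^3) = (x' * t) *s axis 1 1"
      by (simp add: vec_eq_iff forall_3 axis_def)
    then show ?thesis
      using L unfolding complex_derivative_at_def by metis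
  qed
  ultimately have wP: "((\<lambda>m. ?w (P m)) has_derivative (\<lambda>t. (x' * t) *s axis 1 1)) (at l)"
    by simp
  have comp: "((\<lambda>m. ?w (P m) $ i) has_field_derivative x' * axis 1 1 $ i) (at l)" for i
  proof -
    have "(\<lambda>t. ((x' * t) *s axis 1 1) $ i) = (*) (x' * axis 1 1 $ i)"
      by (simp add: fun_eq_iff mult.assoc mult.commute)
    then show ?thesis
      using has_derivative_compose[OF wP has_derivative_component[of i]]
      by (simp add: has_field_derivative_def)
  qed
  have c: "((\<lambda>m. ?w (P m) $ 1) has_field_derivative x') (at l)"
      "((\<lambda>m. ?w (P m) $ 2) has_field_derivative 0) (at l)"
      "((\<lambda>m. ?w (P m) $ 3) has_field_derivative 0) (at l)"
    using comp[of 1] comp[of 2] comp[of 3] by (simp_all add: axis_def)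
  have "((\<lambda>m. fibre_functional B C m (?w (P m))) has_field_derivative
      x' * q $ 2 + (2 * q $ 2 + q $ 1 * q $ 3 - B) + l * (x' * q $ 3)) (at l)"
    unfolding fibre_functional_def
    by (rule derivative_eq_intros c refl)+ (simp add: Pl q(3) algebra_simps)
  note d1 = this
  have d2: "((\<lambda>m. m ^ (2 * n) * fibre_functional B C m (P m)) has_field_derivative
      of_nat (2 * n) * l ^ (2 * n - 1) * fibre_functional B C l q
      + l ^ (2 * n) * (x' * q $ 2 + (2 * q $ 2 + q $ 1 * q $ 3 - B) + l * (x' * q $ 3))) (at l)"
    unfolding fibre_functional_def P_def vector_3
    by (rule derivative_eq_intros x refl)+ (simp add: xl fibre_functional_def algebra_simps)
  have ev: "eventually (\<lambda>m. fibre_functional B C m (?w (P m)) = m ^ (2 * n) * fibre_functional B C m (P m)) (nhds l)"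
    using t1_space_nhds[OF q(2)]
    by eventually_elim (rule fibre_functional_gx_funpow, simp_all add: P_def x_def)
  from d1 d2 DERIV_cong_ev[OF refl ev refl] have "of_nat (2 * n) * l ^ (2 * n - 1) * fibre_functional B C l q
      + l ^ (2 * n) * (x' * q $ 2 + (2 * q $ 2 + q $ 1 * q $ 3 - B) + l * (x' * q $ 3))
      = x' * q $ 2 + (2 * q $ 2 + q $ 1 * q $ 3 - B) + l * (x' * q $ 3)"
    using DERIV_unique by blast
  moreover have "fibre_functional B C l q = l ^ (2 * n) * fibre_functional B C l q"
    using fibre_functional_gx_funpow[OF q(1,2), of B C n] q(3) by simp
  \<comment> \<open>As \<open>q\<close> is fixed, either the functional already vanishes or the
    factor is 1, and then the common terms of both derivatives cancel.\<close>
  then have "l ^ (2 * n) = 1 \<or> fibre_functional B C l q = 0"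
    by auto
  ultimately show ?thesis
    using q(2,4) by auto
qed

text \<open>The iterate preserves the first coordinate and fixes the fibre of \<open>q\<close>
  pointwise. Hence \<open>L - id\<close> maps into the plane \<open>v $ 1 = 0\<close> and kills this
  plane, so \<open>L\<close> is unipotent. Were it the identity on tangent vectors, both functionals
  and with them both gradient entries would vanish at \<open>q\<close>.\<close>

lemma parabolic_points_root_of_unity:
  assumes q: "q \<in> surface A B C D" "q $ 1 = - (l + 1 / l)"
    and l: "l \<noteq> 0" "l\<^sup>2 \<noteq> 1" "l ^ (2 * n) = 1" "n > 0"
    and grad: "surface_grad A B C q $ 2 \<noteq> 0 \<or> surface_grad A B C q $ 3 \<noteq> 0"
  shows "q \<in> parabolic_points A B C D"
proof -
  let ?w = "gx B C ^^ n"
  let ?G = "surface_grad A B C q"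
  have w: "?w \<in> even_words A B C"
    by (intro even_words_funpow gx_even_words)
  obtain L where L: "complex_derivative_at ?w L q"
    using holomorphic_map_derivative[OF even_words_holomorphic_map[OF w]] .
  note Ls = complex_derivative_at_linear[OF L]
  have fixes_fibre: "?w p = p" if "p $ 1 = q $ 1" for p
    using gx_funpow_fixes_fibre[of p l n] that q(2) l by simp
  have L1: "L v $ 1 = v $ 1" for v
  proof -
    have "((\<lambda>p. ?w p $ 1) has_derivative (\<lambda>v. L v $ 1)) (at q)"
      using has_derivative_compose[OF _ has_derivative_component] L
      unfolding complex_derivative_at_def by blast
    then have "(\<lambda>v. L v $ 1) = (\<lambda>v. v $ 1)"
      unfolding gx_funpow_nth_1 using has_derivative_component has_derivative_unique by blast
    then show ?thesis by metis
  qed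
  have L_fibre: "L v = v" if "v $ 1 = 0" for v
  proof -
    have d: "((\<lambda>t::real. q + t *\<^sub>R v) has_derivative (\<lambda>t. t *\<^sub>R v)) (at 0)"
      by (auto intro!: derivative_eq_intros)
    have "(?w has_derivative L) (at (q + 0 *\<^sub>R v))"
      using L by (simp add: complex_derivative_at_def)
    from has_derivative_compose[OF d this]
    have "((\<lambda>t::real. ?w (q + t *\<^sub>R v)) has_derivative (\<lambda>t. L (t *\<^sub>R v))) (at 0)" .
    moreover have "?w (q + t *\<^sub>R v) = q + t *\<^sub>R v" for t
      by (rule fixes_fibre) (simp add: that)
    ultimately have "((\<lambda>t::real. q + t *\<^sub>R v) has_derivative (\<lambda>t. L (t *\<^sub>R v))) (at 0)"
      by (simp only:)
    from fun_cong[OF has_derivative_unique[OF this d], of 1] show ?thesis by simp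
  qed
  \<comment> \<open>A tangent vector transverse to the fibre, found by solving the tangency equation
    for a coordinate whose gradient entry is nonzero.\<close>
  define \<xi> :: "complex^3" where
    "\<xi> = (if ?G $ 2 \<noteq> 0 then vector [1, - ?G $ 1 / ?G $ 2, 0] else vector [1, 0, - ?G $ 1 / ?G $ 3])"
  have \<xi>: "\<xi> $ 1 = 1" "\<xi> \<in> tangent_plane A B C q"
    using grad by (auto simp: \<xi>_def tangent_plane_eq)
  have "L \<xi> \<noteq> \<xi>"
  proof
    assume "L \<xi> = \<xi>"
    \<comment> \<open>\<open>\<xi>\<close> and \<open>axis 1 1\<close> differ by a fibre direction,
      so \<open>L\<close> fixes both or neither.\<close>
    moreover have "L (\<xi> - axis 1 1) = \<xi> - axis 1 1"
      by (rule L_fibre) (simp add: \<xi> axis_def)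
    ultimately have e: "L (axis 1 1) = axis 1 1"
      by (simp add: Ls)
    have "fibre_functional B C l q = 0" "fibre_functional B C (1 / l) q = 0"
      by (rule fibre_functional_0_if_derivative_id[OF L e]; use q(2) l fixes_fibre[of q] in simp)+
    then show False
      using fibre_functional_both_0[OF _ _ l(1,2), of B C q A] grad by blast
  qed
  moreover have "L (L \<xi> - \<xi>) = L \<xi> - \<xi>"
    by (rule L_fibre) (simp add: L1)
  moreover have "smooth_point A B C D q"
    using grad q(1) by (auto simp: smooth_point_def)
  ultimately have "parabolic_point A B C D ?w q"
    unfolding parabolic_point_def using L w \<xi> fixes_fibre[of q] by blast
  then show ?thesis
    by (auto simp: parabolic_points_def)
qed

text \<open>The last condition says that the centre of the conic over \<open>x\<close>, where \<open>g\<^sub>x\<close> is not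
  parabolic, does not lie on the surface.\<close>

definition resonant_values :: "complex \<Rightarrow> complex \<Rightarrow> complex \<Rightarrow> complex \<Rightarrow> complex set" where
  "resonant_values A B C D = {x. \<exists>l n. l \<noteq> 0 \<and> l\<^sup>2 \<noteq> 1 \<and> l ^ (2 * n) = 1 \<and> n > 0 \<and> x = - (l + 1 / l) \<and>
     (x\<^sup>2 - A * x - D) * (4 - x\<^sup>2) \<noteq> B\<^sup>2 + C\<^sup>2 - x * B * C}"

lemma parabolic_points_resonant_1:
  assumes "q \<in> surface A B C D" "q $ 1 \<in> resonant_values A B C D"
  shows "q \<in> parabolic_points A B C D"
proof -
  obtain l n where l: "l \<noteq> 0" "l\<^sup>2 \<noteq> 1" "l ^ (2 * n) = 1" "n > 0" "q $ 1 = - (l + 1 / l)"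
    "((q$1)\<^sup>2 - A * q$1 - D) * (4 - (q$1)\<^sup>2) \<noteq> B\<^sup>2 + C\<^sup>2 - q$1 * B * C"
    using assms(2) by (auto simp: resonant_values_def)
  have "surface_grad A B C q $ 2 \<noteq> 0 \<or> surface_grad A B C q $ 3 \<noteq> 0"
  proof (rule ccontr)
    assume "\<not> ?thesis"
    \<comment> \<open>The vanishing entries express \<open>B\<close> and \<open>C\<close> through
      \<open>q\<close>; the surface equation then becomes the excluded identity.\<close>
    then have e: "B = 2 * q$2 + q$1 * q$3" "C = 2 * q$3 + q$1 * q$2"
      by (simp_all add: surface_grad_def)
    have "(q$1)\<^sup>2 + (q$2)\<^sup>2 + (q$3)\<^sup>2 + q$1 * q$2 * q$3 = A * q$1 + B * q$2 + C * q$3 + D"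
      using assms(1) by (simp add: surface_def)
    then have "((q$1)\<^sup>2 - A * q$1 - D) * (4 - (q$1)\<^sup>2) = B\<^sup>2 + C\<^sup>2 - q$1 * B * C"
      unfolding e by algebra
    then show False using l(6) by simp
  qed
  then show ?thesis
    using parabolic_points_root_of_unity[OF assms(1) l(5,1-4)] by blast
qed

text \<open>\<open>rot\<close> brings the second coordinate to the front, and its third power is the
  identity.\<close>

lemma parabolic_points_resonant_2:
  assumes "q \<in> surface A B C D" "q $ 2 \<in> resonant_values B C A D"
  shows "q \<in> parabolic_points A B C D"
proof -
  have "rot q \<in> parabolic_points B C A D"
    using assms by (intro parabolic_points_resonant_1) (simp_all add: surface_rot)
  then have "rot (rot (rot q)) \<in> parabolic_points A B C D"
    using parabolic_points_rot by blast
  moreover have "rot (rot (rot q)) = q"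
    by (simp add: vec_eq_iff forall_3)
  ultimately show ?thesis by simp
qed

lemma parabolic_points_resonant_3:
  assumes "q \<in> surface A B C D" "q $ 3 \<in> resonant_values C A B D"
  shows "q \<in> parabolic_points A B C D"
proof -
  have "rot q \<in> parabolic_points B C A D"
    using assms by (intro parabolic_points_resonant_2) (simp_all add: surface_rot)
  then have "rot (rot (rot q)) \<in> parabolic_points A B C D"
    using parabolic_points_rot by blast
  moreover have "rot (rot (rot q)) = q"
    by (simp add: vec_eq_iff forall_3)
  ultimately show ?thesis by simp
qed

section \<open>Density of the resonant values in [-2, 2]\<close>

lemma finite_degenerate_fibres:
  fixes A B C D :: complex
  shows "finite {x. (x\<^sup>2 - A * x - D) * (4 - x\<^sup>2) = B\<^sup>2 + C\<^sup>2 - x * B * C}"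
proof -
  \<comment> \<open>The difference of the two sides, expanded; the leading coefficient -1 rules out
    the zero polynomial for all parameters.\<close>
  let ?p = "[:- 4 * D - B\<^sup>2 - C\<^sup>2, B * C - 4 * A, 4 + D, A, -1:]"
  have "{x. (x\<^sup>2 - A * x - D) * (4 - x\<^sup>2) = B\<^sup>2 + C\<^sup>2 - x * B * C} \<subseteq> {x. poly ?p x = 0}"
    by (auto simp: algebra_simps power2_eq_square)
  moreover have "finite {x. poly ?p x = 0}"
    by (rule poly_roots_finite) simp
  ultimately show ?thesis
    by (rule finite_subset)
qed

lemma infinite_Rats_Ioo:
  fixes a b :: real
  assumes "a < b" shows "infinite (\<rat> \<inter> {a<..<b})"
proof -
  obtain r where r: "r \<in> \<rat>" "a < r" "r < b"
    using Rats_dense_in_real[OF assms] by blast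
  obtain s where s: "s \<in> \<rat>" "r < s" "s < b"
    using Rats_dense_in_real[OF r(3)] by blast
  define f where "f = (\<lambda>n::nat. r + (s - r) / of_nat (n + 1))"
  have "inj f"
    using s(2) by (auto simp: inj_def f_def frac_eq_eq)
  moreover have "range f \<subseteq> \<rat> \<inter> {a<..<b}"
  proof -
    have "f n \<in> \<rat>" for n
      unfolding f_def using r s by (intro Rats_add Rats_divide Rats_diff Rats_of_nat)
    moreover have "r < f n" for n
      using s(2) by (simp add: f_def)
    moreover have "f n \<le> s" for n
      using s(2) frac_le[of "s - r" "s - r" 1 "of_nat (n + 1)"] by (simp add: f_def)
    ultimately show ?thesis
      using r s by (fastforce intro: less_trans[of a r] le_less_trans[of _ s b])
  qed
  ultimately show ?thesis
    using range_inj_infinite finite_subset by blast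
qed

text \<open>For \<open>l = cis (pi * a)\<close> the value \<open>- (l + 1 / l)\<close> is
  \<open>- 2 * cos (pi * a)\<close>, and rational \<open>a\<close> gives roots of unity. Infinitely
  many of these values near \<open>t\<close> outlast the removal of the finitely many degenerate
  fibres.\<close>

lemma infinite_resonant_values:
  assumes "t \<in> {-2..2::real}" "e > 0"
  shows "infinite (resonant_values A B C D \<inter> ball (of_real t) e)"
proof -
  define f where "f = (\<lambda>a::real. complex_of_real (- 2 * cos (pi * a)))"
  define a0 where "a0 = arccos (- t / 2) / pi"
  have a0: "0 \<le> a0" "a0 \<le> 1" "f a0 = of_real t"
    using assms(1) arccos_bounded[of "- t / 2"] by (simp_all add: a0_def f_def)
  have "isCont f a0"
    unfolding f_def by (intro continuous_intros)
  then obtain d where d: "d > 0" "\<And>a. dist a a0 < d \<Longrightarrow> dist (f a) (of_real t) < e"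
    using assms(2) a0(3) unfolding continuous_at_eps_delta by (metis dist_norm)
  \<comment> \<open>Cutting the interval down to \<open>(0, 1)\<close> makes the cosine injective on
    it and keeps \<open>l\<close> away from 1 and -1.\<close>
  let ?I = "{max 0 (a0 - d)<..<min 1 (a0 + d)}"
  have "max 0 (a0 - d) < min 1 (a0 + d)"
    using a0 d(1) by (simp add: max_def min_def)
  then have inf: "infinite (\<rat> \<inter> ?I)"
    by (rule infinite_Rats_Ioo)
  have "inj_on f (\<rat> \<inter> ?I)"
  proof (rule inj_onI)
    fix a b assume "a \<in> \<rat> \<inter> ?I" "b \<in> \<rat> \<inter> ?I" "f a = f b"
    then have "cos (pi * a) = cos (pi * b)" "0 \<le> pi * a" "pi * a \<le> pi" "0 \<le> pi * b" "pi * b \<le> pi"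
      by (auto simp: f_def simp del: of_real_mult)
    then have "pi * a = pi * b"
      using cos_inj_pi by blast
    then show "a = b" by simp
  qed
  then have "infinite (f ` (\<rat> \<inter> ?I))"
    using inf finite_imageD by blast
  then have "infinite (f ` (\<rat> \<inter> ?I) - {x. (x\<^sup>2 - A * x - D) * (4 - x\<^sup>2) = B\<^sup>2 + C\<^sup>2 - x * B * C})"
    using finite_degenerate_fibres by simp
  moreover have "f ` (\<rat> \<inter> ?I) - {x. (x\<^sup>2 - A * x - D) * (4 - x\<^sup>2) = B\<^sup>2 + C\<^sup>2 - x * B * C}
      \<subseteq> resonant_values A B C D \<inter> ball (of_real t) e"
  proof
    fix x assume "x \<in> f ` (\<rat> \<inter> ?I) - {x. (x\<^sup>2 - A * x - D) * (4 - x\<^sup>2) = B\<^sup>2 + C\<^sup>2 - x * B * C}"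
    then obtain a where a: "a \<in> \<rat>" "a \<in> ?I" "x = f a"
      and x: "(x\<^sup>2 - A * x - D) * (4 - x\<^sup>2) \<noteq> B\<^sup>2 + C\<^sup>2 - x * B * C"
      by blast
    define l where "l = cis (pi * a)"
    obtain i n where n: "n > 0" "a = of_int i / of_int n"
      using Rats_cases'[OF a(1)] by metis
    have "l \<noteq> 0"
      by (simp add: l_def)
    moreover have "l\<^sup>2 \<noteq> 1"
    proof
      assume "l\<^sup>2 = 1"
      then have "l = 1 \<or> l = -1"
        by (simp add: power2_eq_1_iff)
      then have "sin (pi * a) = 0"
        by (auto simp: l_def complex_eq_iff)
      moreover have "sin (pi * a) > 0"
        using a(2) by (intro sin_gt_zero) auto
      ultimately show False by simp
    qed
    moreover have "l ^ (2 * nat n) = 1"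
    proof -
      have "l ^ (2 * nat n) = cis (of_nat (2 * nat n) * (pi * a))"
        by (simp add: l_def Complex.DeMoivre)
      also have "of_nat (2 * nat n) * (pi * a) = 2 * pi * of_int i"
        using n by simp
      also have "cis (2 * pi * of_int i) = 1"
        by (simp add: cis_multiple_2pi)
      finally show ?thesis .
    qed
    moreover have "x = - (l + 1 / l)"
      by (simp add: a(3) f_def l_def complex_eq_iff divide_inverse cis_inverse)
    moreover have "x \<in> ball (of_real t) e"
      using a d(2)[of a] by (auto simp: dist_commute dist_real_def)
    ultimately show "x \<in> resonant_values A B C D \<inter> ball (of_real t) e"
      using n(1) x unfolding resonant_values_def by (intro IntI CollectI exI[of _ l] exI[of _ "nat n"] conjI) auto
  qed
  ultimately show ?thesis
    using finite_subset by blast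
qed

lemma two_resonant_values:
  obtains a b where "a \<in> resonant_values A B C D" "b \<in> resonant_values A B C D" "a \<noteq> b"
proof -
  have "infinite (resonant_values A B C D)"
    using infinite_resonant_values[of 0 1 A B C D] by auto
  then show ?thesis
    using that by (metis finite.emptyI finite_insert finite_subset insertI1 subsetI empty_iff insert_iff)
qed

section \<open>Singular points of the surface\<close>

text \<open>Completes the square in the third coordinate, after multiplication by 4.\<close>

lemma surface_eq_discriminant:
  "p \<in> surface A B C D \<longleftrightarrow> (2 * p$3 + p$1 * p$2 - C)\<^sup>2 =
     (p$1 * p$2 - C)\<^sup>2 - 4 * ((p$1)\<^sup>2 + (p$2)\<^sup>2 - A * p$1 - B * p$2 - D)"
proof -
  have "(2 * p$3 + p$1 * p$2 - C)\<^sup>2 - ((p$1 * p$2 - C)\<^sup>2 - 4 * ((p$1)\<^sup>2 + (p$2)\<^sup>2 - A * p$1 - B * p$2 - D))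
      = 4 * surface_poly A B C D p"
    unfolding surface_poly_def by algebra
  then show ?thesis
    unfolding surface_eq_zero_set by auto
qed

text \<open>With the second coordinate frozen, the surface equation is quadratic in the third. Its
  discriminant vanishes at \<open>p\<close>, because the third gradient entry does, so its roots
  tend to \<open>p $ 3\<close>.\<close>

lemma nearby_fibres_at_singular_point:
  assumes p: "p \<in> surface A B C D" "surface_grad A B C p = 0" and "e > 0"
  obtains d where "d > 0" "\<And>x. dist x (p $ 1) < d \<Longrightarrow> \<exists>q\<in>surface A B C D. q $ 1 = x \<and> dist q p < e"
proof -
  define \<Delta> where "\<Delta> = (\<lambda>x. (x * p$2 - C)\<^sup>2 - 4 * (x\<^sup>2 + (p$2)\<^sup>2 - A * x - B * p$2 - D))"
  define Q :: "complex \<Rightarrow> complex^3" where "Q = (\<lambda>x. vector [x, p$2, (C - x * p$2 + csqrt (\<Delta> x)) / 2])"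
  have Q: "Q x \<in> surface A B C D" for x
  proof -
    have "2 * Q x $ 3 + Q x $ 1 * Q x $ 2 - C = csqrt (\<Delta> x)"
      by (simp add: Q_def field_simps)
    then show ?thesis
      unfolding surface_eq_discriminant by (simp add: Q_def \<Delta>_def)
  qed
  have g3: "2 * p$3 + p$1 * p$2 - C = 0"
    using p(2) by (simp add: surface_grad_def vec_eq_iff forall_3)
  then have "\<Delta> (p $ 1) = 0"
    using p(1) unfolding surface_eq_discriminant by (simp add: \<Delta>_def)
  moreover have "\<Delta> \<midarrow>p $ 1\<rightarrow> \<Delta> (p $ 1)"
    unfolding \<Delta>_def by (intro tendsto_intros)
  \<comment> \<open>Only the modulus of the root is controlled, so the branch cut of
    \<open>csqrt\<close> does no harm.\<close>
  ultimately have "((\<lambda>x. sqrt (norm (\<Delta> x))) \<longlongrightarrow> sqrt (norm (0::complex))) (at (p $ 1))"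
    by (intro tendsto_intros) simp
  then have c: "((\<lambda>x. csqrt (\<Delta> x)) \<longlongrightarrow> 0) (at (p $ 1))"
    unfolding norm_zero real_sqrt_zero norm_csqrt[symmetric] by (rule tendsto_norm_zero_cancel)
  have "((\<lambda>x. Q x $ 3) \<longlongrightarrow> (C - p$1 * p$2 + 0) / 2) (at (p $ 1))"
    unfolding Q_def vector_3 by (intro tendsto_intros c) simp
  moreover have "(C - p$1 * p$2 + 0) / 2 = p $ 3"
    using g3 by (simp add: algebra_simps)
  ultimately have "((\<lambda>x. Q x $ 3) \<longlongrightarrow> p $ 3) (at (p $ 1))"
    by simp
  moreover have "((\<lambda>x. Q x $ 1) \<longlongrightarrow> p $ 1) (at (p $ 1))" "((\<lambda>x. Q x $ 2) \<longlongrightarrow> p $ 2) (at (p $ 1))"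
    by (simp_all add: Q_def)
  ultimately have "((\<lambda>x. Q x $ i) \<longlongrightarrow> p $ i) (at (p $ 1))" for i
    using exhaust_3[of i] by auto
  then have "(Q \<longlongrightarrow> p) (at (p $ 1))"
    by (rule vec_tendstoI)
  then obtain d where d: "d > 0" "\<And>x. x \<noteq> p $ 1 \<Longrightarrow> dist x (p $ 1) < d \<Longrightarrow> dist (Q x) p < e"
    using \<open>e > 0\<close> unfolding Lim_at by (metis zero_less_dist_iff)
  show ?thesis
  proof (rule that[OF d(1)])
    fix x assume "dist x (p $ 1) < d"
    \<comment> \<open>The limit says nothing at \<open>x = p $ 1\<close>; there \<open>p\<close>
      itself is the required point.\<close>
    then have "x = p $ 1 \<or> dist (Q x) p < e" using d(2) by blast
    moreover have "Q x $ 1 = x" by (simp add: Q_def)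
    ultimately show "\<exists>q\<in>surface A B C D. q $ 1 = x \<and> dist q p < e"
      using Q[of x] p(1) \<open>e > 0\<close> by (metis dist_self)
  qed
qed

text \<open>The roots of \<open>l\<^sup>2 + x * l + 1 = 0\<close> are mutually inverse, and a root
  on the unit circle would put \<open>x = - 2 * Re l\<close> into [-2, 2].\<close>

lemma joukowski_preimage:
  fixes x :: complex
  assumes "x \<notin> of_real ` {-2..2}"
  obtains l where "l \<noteq> 0" "norm l < 1" "x = - (l + 1 / l)"
proof -
  define l where "l = (- x + csqrt (x\<^sup>2 - 4)) / 2"
  have sq: "l\<^sup>2 + x * l + 1 = 0"
  proof -
    have "csqrt (x\<^sup>2 - 4) = 2 * l + x" by (simp add: l_def field_simps)
    then have "(2 * l + x)\<^sup>2 = x\<^sup>2 - 4" by (metis power2_csqrt)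
    then have "4 * (l\<^sup>2 + x * l + 1) = 0" by algebra
    then show ?thesis by (simp only: mult_eq_0_iff) simp
  qed
  then have l: "l \<noteq> 0" by auto
  then have x: "x = - (l + 1 / l)"
    using sq by (simp add: field_simps power2_eq_square) (metis add.commute add.left_commute add_eq_0_iff)
  have "norm l \<noteq> 1"
  proof
    assume n: "norm l = 1"
    then have "1 / l = cnj l"
      using l by (simp add: divide_conv_cnj)
    then have "x = of_real (- 2 * Re l)"
      using x by (simp add: complex_eq_iff)
    moreover have "\<bar>Re l\<bar> \<le> 1"
      using n abs_Re_le_cmod[of l] by simp
    then have "- 2 * Re l \<in> {-2..2}" by auto
    ultimately show False using assms by blast
  qed
  then consider "norm l < 1" | "norm l > 1" by linarith
  then show ?thesis
  proof cases
    case 1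
    then show ?thesis using that l x by blast
  next
    case 2
    then show ?thesis using that[of "1 / l"] l x by (simp add: norm_divide add.commute)
  qed
qed

text \<open>The conditions on \<open>B\<close> and \<open>C\<close> say that
  \<open>(x, y, z)\<close> is the centre of its fibre; \<open>(0, 1 / l, 1)\<close> is an
  eigenvector of the linear part of \<open>gx\<close> for the eigenvalue
  \<open>l\<^sup>2\<close>.\<close>

lemma gx_funpow_eigenline:
  assumes "B = 2 * y + x * z" "C = 2 * z + x * y" "x = - (l + 1 / l)" "l \<noteq> 0"
  shows "(gx B C ^^ n) (vector [x, y + w / l, z + w])
     = vector [x, y + l ^ (2 * n) * w / l, z + l ^ (2 * n) * w]"
proof (induction n)
  case (Suc n)
  have step: "gx B C (vector [x, y + v / l, z + v]) = vector [x, y + l\<^sup>2 * v / l, z + l\<^sup>2 * v]" for v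
    using assms(4) unfolding assms(1,2)
    by (simp add: vec_eq_iff forall_3 gx_nth) (simp add: assms(3) field_simps power2_eq_square)
  show ?case
    using Suc step[of "l ^ (2 * n) * w"] by (simp add: power2_eq_square mult.assoc)
qed simp

lemma singular_point_in_closure_parabolic_points:
  assumes p: "p \<in> surface A B C D" "surface_grad A B C p = 0"
  shows "p \<in> closure (parabolic_points A B C D)"
proof (cases "p $ 1 \<in> of_real ` {-2..2}")
  case True
  then obtain t where t: "t \<in> {-2..2}" "p $ 1 = of_real t" by blast
  show ?thesis
    unfolding closure_approachable
  proof (intro allI impI)
    fix e :: real assume "e > 0"
    then obtain d where d: "d > 0" "\<And>x. dist x (p $ 1) < d \<Longrightarrow> \<exists>q\<in>surface A B C D. q $ 1 = x \<and> dist q p < e"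
      using nearby_fibres_at_singular_point[OF p] by metis
    have "resonant_values A B C D \<inter> ball (of_real t) d \<noteq> {}"
      using infinite_resonant_values[OF t(1) d(1), of A B C D] by force
    then obtain x where "x \<in> resonant_values A B C D" "dist x (p $ 1) < d"
      using t(2) by (auto simp: dist_commute)
    then show "\<exists>q\<in>parabolic_points A B C D. dist q p < e"
      using d(2) parabolic_points_resonant_1 by metis
  qed
next
  case False
  then obtain l where l: "l \<noteq> 0" "norm l < 1" "p $ 1 = - (l + 1 / l)"
    using joukowski_preimage by blast
  obtain e where e: "e \<in> resonant_values B C A D"
    using two_resonant_values by metis
  \<comment> \<open>Chosen so that \<open>r\<close> on the contracted line has the resonant second
    coordinate \<open>e\<close>.\<close>
  define w where "w = (e - p $ 2) * l"
  define r :: "complex^3" where "r = vector [p $ 1, p $ 2 + w / l, p $ 3 + w]"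
  have grad: "A = 2 * p$1 + p$2 * p$3" "B = 2 * p$2 + p$1 * p$3" "C = 2 * p$3 + p$1 * p$2"
    using p(2) by (simp_all add: surface_grad_def vec_eq_iff forall_3)
  \<comment> \<open>The gradient vanishes at \<open>p\<close> and the first coordinate is kept, so
    only a quadratic form in the other two displacements remains; the eigenline is isotropic for
    it.\<close>
  have "surface_poly A B C D r - surface_poly A B C D p = (w / l)\<^sup>2 + w\<^sup>2 + p $ 1 * (w / l) * w"
    unfolding grad surface_poly_def r_def vector_3 by algebra
  also have "\<dots> = 0"
    using l(1) unfolding l(3) by (simp add: field_simps power2_eq_square)
  finally have "r \<in> surface A B C D"
    using p(1) by (simp add: surface_eq_zero_set)
  moreover have "r $ 2 = e"
    using l(1) by (simp add: r_def w_def)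
  ultimately have "r \<in> parabolic_points A B C D"
    using e parabolic_points_resonant_2 by metis
  then have par: "(gx B C ^^ n) r \<in> parabolic_points A B C D" for n
    using parabolic_points_even_words_iff[OF even_words_funpow[OF gx_even_words]] by blast
  have "(gx B C ^^ n) r = vector [p $ 1, p $ 2 + l ^ (2 * n) * w / l, p $ 3 + l ^ (2 * n) * w]" for n
    unfolding r_def using gx_funpow_eigenline[OF grad(2,3) l(3,1)] .
  note orbit = this
  have "(\<lambda>n. (l\<^sup>2) ^ n) \<longlonglongrightarrow> 0"
    using l(2) by (intro LIMSEQ_power_zero) (simp add: norm_power abs_square_less_1 power_less_one_iff)
  then have z: "(\<lambda>n. l ^ (2 * n)) \<longlonglongrightarrow> 0"
    by (simp add: power_mult)
  have "(\<lambda>n. (gx B C ^^ n) r $ i) \<longlonglongrightarrow> p $ i" for i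
  proof -
    have "(\<lambda>n. p $ 2 + l ^ (2 * n) * w / l) \<longlonglongrightarrow> p $ 2 + 0 * w / l"
      "(\<lambda>n. p $ 3 + l ^ (2 * n) * w) \<longlonglongrightarrow> p $ 3 + 0 * w"
      using l(1) by (intro tendsto_intros z; simp)+
    then show ?thesis
      using exhaust_3[of i] unfolding orbit by auto
  qed
  then have "(\<lambda>n. (gx B C ^^ n) r) \<longlonglongrightarrow> p"
    by (rule vec_tendstoI)
  then show ?thesis
    unfolding closure_sequential using par by (intro exI[of _ "\<lambda>n. (gx B C ^^ n) r"]) simp
qed

section \<open>Charts at smooth points\<close>

text \<open>Holomorphy is stated along complex lines, the form in which one-variable theorems use
  it. Openness for all smaller radii permits shrinking, and the last clause realises every tangent
  vector as the velocity of a complex line through 0.\<close>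

definition surface_chart ::
    "complex \<Rightarrow> complex \<Rightarrow> complex \<Rightarrow> complex \<Rightarrow> complex^3 \<Rightarrow> (complex^3) set \<Rightarrow> (complex^2 \<Rightarrow> complex^3) \<Rightarrow> real \<Rightarrow> bool" where
  "surface_chart A B C D p U \<sigma> \<delta> \<longleftrightarrow>
     \<delta> > 0 \<and> \<sigma> 0 = p \<and> \<sigma> ` ball 0 \<delta> \<subseteq> surface A B C D \<inter> U \<and>
     inj_on \<sigma> (ball 0 \<delta>) \<and> continuous_on (ball 0 \<delta>) \<sigma> \<and>
     (\<forall>\<eta>\<le>\<delta>. openin (top_of_set (surface A B C D)) (\<sigma> ` ball 0 \<eta>)) \<and>
     (\<forall>a b T i. (\<forall>t\<in>T. a + t *s b \<in> ball 0 \<delta>) \<longrightarrow> (\<lambda>t. \<sigma> (a + t *s b) $ i) holomorphic_on T) \<and>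
     (\<forall>v\<in>tangent_plane A B C p. \<exists>b. ((\<lambda>t. \<sigma> (t *s b)) has_derivative (\<lambda>t. t *s v)) (at 0))"

lemma continuous_on_vector_2:
  assumes "continuous_on S f" "continuous_on S g"
  shows "continuous_on S (\<lambda>x. vector [f x, g x] :: complex^2)"
proof -
  have "(\<lambda>x. vector [f x, g x] :: complex^2) = (\<lambda>x. \<chi> i. if i = 1 then f x else g x)"
    by (simp add: fun_eq_iff vec_eq_iff forall_2)
  moreover have "continuous_on S (\<lambda>x. if i = (1::2) then f x else g x)" for i
    using assms by (cases "i = 1") auto
  ultimately show ?thesis
    by (simp only: continuous_on_vec_lambda)
qed

lemma continuous_on_vector_3:
  assumes "continuous_on S f" "continuous_on S g" "continuous_on S h"
  shows "continuous_on S (\<lambda>x. vector [f x, g x, h x] :: complex^3)"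
proof -
  have "(\<lambda>x. vector [f x, g x, h x] :: complex^3) = (\<lambda>x. \<chi> i. if i = 1 then f x else if i = 2 then g x else h x)"
    by (simp add: fun_eq_iff vec_eq_iff forall_3)
  moreover have "continuous_on S (\<lambda>x. if i = (1::3) then f x else if i = 2 then g x else h x)" for i
    using assms by (cases "i = 1"; cases "i = 2") auto
  ultimately show ?thesis
    by (simp only: continuous_on_vec_lambda)
qed

lemma continuous_on_scalar_mult_line:
  fixes a b :: "complex^'n::finite" shows "continuous_on S (\<lambda>t. a + t *s b)"
proof -
  have "(\<lambda>t. a + t *s b) = (\<lambda>t. \<chi> i. a $ i + t * b $ i)"
    by (simp add: fun_eq_iff vec_eq_iff)
  then show ?thesis
    by (simp only:) (intro continuous_intros)
qed

text \<open>The quadratic formula gives the implicit function for the third coordinate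
  explicitly.\<close>

lemma surface_chart_grad_3:
  assumes p: "p \<in> surface A B C D" "surface_grad A B C p $ 3 \<noteq> 0" and U: "open U" "p \<in> U"
  obtains \<sigma> \<delta> where "surface_chart A B C D p U \<sigma> \<delta>"
proof -
  define w where "w = surface_grad A B C p $ 3"
  define x where "x = (\<lambda>u::complex^2. p $ 1 + u $ 1)"
  define y where "y = (\<lambda>u::complex^2. p $ 2 + u $ 2)"
  \<comment> \<open>The discriminant divided by its value \<open>w\<^sup>2\<close> at
    \<open>p\<close>: thus \<open>R 0 = 1\<close> lies away from the branch cut of
    \<open>csqrt\<close>.\<close>
  define R where "R = (\<lambda>u. ((x u * y u - C)\<^sup>2 - 4 * ((x u)\<^sup>2 + (y u)\<^sup>2 - A * x u - B * y u - D)) / w\<^sup>2)"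
  define \<sigma> :: "complex^2 \<Rightarrow> complex^3" where
    "\<sigma> = (\<lambda>u. vector [x u, y u, (C - x u * y u + w * csqrt (R u)) / 2])"
  have w: "w \<noteq> 0" "w = 2 * p$3 + p$1 * p$2 - C"
    using p(2) by (simp_all add: w_def surface_grad_def)
  have cont_xy: "continuous_on S x" "continuous_on S y" for S
    unfolding x_def y_def by (intro continuous_intros)+
  have cont_R: "continuous_on S R" for S
    unfolding R_def using w(1) by (intro continuous_intros cont_xy) simp
  have "w\<^sup>2 = (p$1 * p$2 - C)\<^sup>2 - 4 * ((p$1)\<^sup>2 + (p$2)\<^sup>2 - A * p$1 - B * p$2 - D)"
    using p(1) unfolding surface_eq_discriminant w(2)[symmetric] .
  then have "R 0 = w\<^sup>2 / w\<^sup>2"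
    by (simp only: R_def x_def y_def zero_index add_0_right)
  then have R0: "R 0 = 1"
    using w(1) by simp
  have \<sigma>0: "\<sigma> 0 = p"
    using w(2) by (simp add: \<sigma>_def R0 x_def y_def vec_eq_iff forall_3 field_simps)
  let ?P = "{u. Re (R u) > 0}"
  have "open ?P"
    by (intro open_Collect_less continuous_intros cont_R)
  have csqrt: "continuous_on ?P (\<lambda>u. csqrt (R u))"
    by (rule continuous_on_compose2[OF holomorphic_on_imp_continuous_on[OF holomorphic_on_csqrt] cont_R])
      (auto simp: complex_nonpos_Reals_iff)
  have cont_\<sigma>: "continuous_on ?P \<sigma>"
    unfolding \<sigma>_def by (intro continuous_on_vector_3 continuous_intros cont_xy csqrt) simp
  have "open (?P \<inter> \<sigma> -` U)"
    using continuous_open_preimage[OF cont_\<sigma> \<open>open ?P\<close> U(1)] .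
  moreover have "0 \<in> ?P \<inter> \<sigma> -` U"
    using U(2) by (simp add: R0 \<sigma>0)
  ultimately obtain \<delta> where \<delta>: "\<delta> > 0" "ball 0 \<delta> \<subseteq> ?P \<inter> \<sigma> -` U"
    using open_contains_ball by blast
  have \<sigma>_eq: "2 * \<sigma> u $ 3 + \<sigma> u $ 1 * \<sigma> u $ 2 - C = w * csqrt (R u)" for u
    by (simp add: \<sigma>_def field_simps)
  have surf: "\<sigma> u \<in> surface A B C D" for u
    unfolding surface_eq_discriminant \<sigma>_eq using w(1) by (simp add: power_mult_distrib R_def \<sigma>_def)
  let ?u = "\<lambda>q::complex^3. vector [q$1 - p$1, q$2 - p$2] :: complex^2"
  \<comment> \<open>Positive real part of the normalised root singles out the sheet given by
    \<open>csqrt\<close>, so that the image of a ball is cut out of the surface by open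
    conditions.\<close>
  let ?O = "\<lambda>\<eta>. {q. norm (?u q) < \<eta>} \<inter> {q. Re ((2 * q$3 + q$1 * q$2 - C) / w) > 0}"
  have u\<sigma>: "?u (\<sigma> u) = u" for u
    by (simp add: \<sigma>_def x_def y_def vec_eq_iff forall_2)
  have image: "\<sigma> ` ball 0 \<eta> = surface A B C D \<inter> ?O \<eta>" if "\<eta> \<le> \<delta>" for \<eta>
  proof (intro equalityI subsetI)
    fix q assume "q \<in> \<sigma> ` ball 0 \<eta>"
    then obtain u where u: "q = \<sigma> u" "norm u < \<eta>" by auto
    then have "Re (R u) > 0" using \<delta>(2) that by (auto simp: subset_iff)
    moreover have "(2 * q$3 + q$1 * q$2 - C) / w = csqrt (R u)"
      using w(1) \<sigma>_eq[of u] u(1) by simp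
    ultimately show "q \<in> surface A B C D \<inter> ?O \<eta>"
      using surf[of u] u u\<sigma>[of u] by (auto simp: add_nonneg_pos)
  next
    fix q assume q: "q \<in> surface A B C D \<inter> ?O \<eta>"
    have xy: "x (?u q) = q $ 1" "y (?u q) = q $ 2"
      by (simp_all add: x_def y_def)
    have "csqrt (R (?u q)) = (2 * q$3 + q$1 * q$2 - C) / w"
    proof (rule csqrt_unique)
      have "(2 * q$3 + q$1 * q$2 - C)\<^sup>2 =
          (q$1 * q$2 - C)\<^sup>2 - 4 * ((q$1)\<^sup>2 + (q$2)\<^sup>2 - A * q$1 - B * q$2 - D)"
        using q surface_eq_discriminant by blast
      then show "((2 * q$3 + q$1 * q$2 - C) / w)\<^sup>2 = R (?u q)"
        by (simp only: R_def xy power_divide)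
    qed (use q in simp)
    then have "\<sigma> (?u q) = q"
      using w(1) by (simp add: \<sigma>_def xy vec_eq_iff forall_3)
    then show "q \<in> \<sigma> ` ball 0 \<eta>"
      using q by (intro image_eqI[of _ _ "?u q"]) auto
  qed
  have "open (?O \<eta>)" for \<eta>
    using w(1) by (intro open_Int open_Collect_less continuous_intros continuous_on_vector_2) auto
  then have op: "openin (top_of_set (surface A B C D)) (\<sigma> ` ball 0 \<eta>)" if "\<eta> \<le> \<delta>" for \<eta>
    unfolding image[OF that] openin_open by blast
  have hol: "(\<lambda>t. \<sigma> (a + t *s b) $ i) holomorphic_on T" if "\<forall>t\<in>T. a + t *s b \<in> ball 0 \<delta>" for a b T i
  proof -
    have xy: "(\<lambda>t. x (a + t *s b)) holomorphic_on T" "(\<lambda>t. y (a + t *s b)) holomorphic_on T"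
      unfolding x_def y_def vector_add_component vector_smult_component by (intro holomorphic_intros)+
    have "(\<lambda>t. R (a + t *s b)) holomorphic_on T"
      unfolding R_def using w(1) by (intro holomorphic_intros xy) simp
    moreover have "R (a + t *s b) \<in> - \<real>\<^sub>\<le>\<^sub>0" if "t \<in> T" for t
      using \<delta>(2) that \<open>\<forall>t\<in>T. a + t *s b \<in> ball 0 \<delta>\<close> by (force simp: complex_nonpos_Reals_iff)
    ultimately have "(\<lambda>t. csqrt (R (a + t *s b))) holomorphic_on T"
      using holomorphic_on_compose_gen[OF _ holomorphic_on_csqrt, of "\<lambda>t. R (a + t *s b)" T]
      by (auto simp: comp_def)
    then have "(\<lambda>t. (C - x (a + t *s b) * y (a + t *s b) + w * csqrt (R (a + t *s b))) / 2) holomorphic_on T"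
      by (intro xy holomorphic_on_divide holomorphic_on_add holomorphic_on_diff holomorphic_on_mult holomorphic_on_const)
        simp_all
    then show ?thesis
      using xy exhaust_3[of i] by (auto simp: \<sigma>_def)
  qed
  have der: "\<exists>b. ((\<lambda>t. \<sigma> (t *s b)) has_derivative (\<lambda>t. t *s v)) (at 0)" if v: "v \<in> tangent_plane A B C p" for v
  proof -
    define b :: "complex^2" where "b = vector [v $ 1, v $ 2]"
    let ?T = "(\<lambda>t. 0 + t *s b) -` ball 0 \<delta>"
    have "open ?T"
      by (intro open_vimage continuous_on_scalar_mult_line) simp
    moreover have "(\<lambda>t. \<sigma> (0 + t *s b) $ 3) holomorphic_on ?T"
      by (rule hol) simp
    moreover have "0 \<in> ?T"
      using \<delta>(1) by simp
    ultimately have "(\<lambda>t. \<sigma> (0 + t *s b) $ 3) field_differentiable (at 0)"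
      using holomorphic_on_imp_differentiable_at by blast
    then obtain z' where z': "((\<lambda>t. \<sigma> (t *s b) $ 3) has_field_derivative z') (at 0)"
      unfolding field_differentiable_def by auto
    have "((\<lambda>t. vector [\<sigma> (t *s b) $ 1, \<sigma> (t *s b) $ 2, \<sigma> (t *s b) $ 3] :: complex^3)
        has_derivative (\<lambda>t. vector [t * v $ 1, t * v $ 2, z' * t])) (at 0)"
      using z' by (intro has_derivative_vector_3)
        (auto simp: \<sigma>_def x_def y_def b_def has_field_derivative_def intro!: derivative_eq_intros)
    note * = this
    have d: "((\<lambda>t. \<sigma> (t *s b)) has_derivative (\<lambda>t. vector [t * v $ 1, t * v $ 2, z' * t])) (at 0)"
    proof -
      have "(vector [q $ 1, q $ 2, q $ 3] :: complex^3) = q" for q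
        by (simp add: vec_eq_iff forall_3)
      with * show ?thesis by (simp only:)
    qed
    have "(surface_poly A B C D has_derivative (\<lambda>v. \<Sum>i\<in>UNIV. surface_grad A B C p $ i * v $ i)) (at (\<sigma> (0 *s b)))"
      using surface_poly_has_derivative \<sigma>0 by simp
    from has_derivative_compose[OF d this]
    have "((\<lambda>t. surface_poly A B C D (\<sigma> (t *s b))) has_derivative
        (\<lambda>t. surface_grad A B C p $ 1 * (t * v $ 1) + surface_grad A B C p $ 2 * (t * v $ 2)
           + surface_grad A B C p $ 3 * (z' * t))) (at 0)"
      by (simp add: sum_3)
    moreover have "surface_poly A B C D (\<sigma> (t *s b)) = 0" for t
      using surf unfolding surface_eq_zero_set by simp
    ultimately have "(\<lambda>t. surface_grad A B C p $ 1 * (t * v $ 1) + surface_grad A B C p $ 2 * (t * v $ 2)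
           + surface_grad A B C p $ 3 * (z' * t)) = (\<lambda>t. 0)"
      using has_derivative_unique[OF _ has_derivative_const] by simp
    \<comment> \<open>The curve stays on the surface, so its velocity is tangent; as the third
      gradient entry is nonzero, the first two components of \<open>v\<close> determine the
      third.\<close>
    from fun_cong[OF this, of 1] have "surface_grad A B C p $ 3 * z' = surface_grad A B C p $ 3 * v $ 3"
      using v unfolding tangent_plane_eq mem_Collect_eq by (simp, algebra)
    then have "z' = v $ 3"
      using p(2) by simp
    then have "(\<lambda>t. vector [t * v $ 1, t * v $ 2, z' * t]) = (\<lambda>t. t *s v)"
      by (simp add: fun_eq_iff vec_eq_iff forall_3)
    then show ?thesis
      using d by auto
  qed
  have "inj_on \<sigma> (ball 0 \<delta>)"
    using u\<sigma> by (metis inj_onI)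
  moreover have "\<sigma> ` ball 0 \<delta> \<subseteq> surface A B C D \<inter> U"
    using \<delta>(2) surf by auto
  moreover have "continuous_on (ball 0 \<delta>) \<sigma>"
    using cont_\<sigma> by (rule continuous_on_subset) (use \<delta>(2) in blast)
  ultimately have "surface_chart A B C D p U \<sigma> \<delta>"
    unfolding surface_chart_def using \<delta>(1) \<sigma>0 op hol der by blast
  then show ?thesis
    using that by blast
qed

lemma rot_unrot_scale: "rot (t *s v) = t *s rot v" "unrot (t *s v) = t *s unrot v"
  by (simp_all add: vec_eq_iff forall_3)

lemma surface_chart_unrot:
  assumes "surface_chart B C A D (rot p) (unrot -` U) \<sigma> \<delta>"
  shows "surface_chart A B C D p U (unrot \<circ> \<sigma>) \<delta>"
proof -
  have c: "\<delta> > 0" "\<sigma> 0 = rot p" "\<sigma> ` ball 0 \<delta> \<subseteq> surface B C A D \<inter> unrot -` U"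
     "inj_on \<sigma> (ball 0 \<delta>)" "continuous_on (ball 0 \<delta>) \<sigma>"
     "\<forall>\<eta>\<le>\<delta>. openin (top_of_set (surface B C A D)) (\<sigma> ` ball 0 \<eta>)"
     "\<forall>a b T i. (\<forall>t\<in>T. a + t *s b \<in> ball 0 \<delta>) \<longrightarrow> (\<lambda>t. \<sigma> (a + t *s b) $ i) holomorphic_on T"
     "\<forall>v\<in>tangent_plane B C A (rot p). \<exists>b. ((\<lambda>t. \<sigma> (t *s b)) has_derivative (\<lambda>t. t *s v)) (at 0)"
    using assms unfolding surface_chart_def by simp_all
  have unrot_surface: "unrot q \<in> surface A B C D \<longleftrightarrow> q \<in> surface B C A D" for q
    using surface_rot[of "unrot q" B C A D] by simp
  have "openin (top_of_set (surface A B C D)) ((unrot \<circ> \<sigma>) ` ball 0 \<eta>)" if "\<eta> \<le> \<delta>" for \<eta>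
  proof -
    have "openin (top_of_set (surface B C A D)) (\<sigma> ` ball 0 \<eta>)"
      using c(6) that by simp
    then obtain V where V: "open V" "\<sigma> ` ball 0 \<eta> = surface B C A D \<inter> V"
      by (auto simp only: openin_open)
    have "(unrot \<circ> \<sigma>) ` ball 0 \<eta> = unrot ` (surface B C A D \<inter> V)"
      using V(2) by (metis image_comp)
    also have "\<dots> = surface A B C D \<inter> rot -` V"
    proof (intro equalityI subsetI)
      fix q assume "q \<in> surface A B C D \<inter> rot -` V"
      then show "q \<in> unrot ` (surface B C A D \<inter> V)"
        by (intro image_eqI[of _ _ "rot q"]) (simp_all add: surface_rot)
    qed (auto simp: unrot_surface)
    finally show ?thesis
      using open_vimage[OF V(1) holomorphic_map_continuous[OF holomorphic_map_rot]]
      by (auto simp: openin_open)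
  qed
  moreover have "(\<lambda>t. (unrot \<circ> \<sigma>) (a + t *s b) $ i) holomorphic_on T"
    if "\<forall>t\<in>T. a + t *s b \<in> ball 0 \<delta>" for a b T i
  proof -
    have "\<forall>i. (\<lambda>t. \<sigma> (a + t *s b) $ i) holomorphic_on T"
      using c(7) that by blast
    then show ?thesis
      unfolding comp_def by (intro holomorphic_map_holomorphic[OF holomorphic_map_unrot]) simp
  qed
  moreover have "\<exists>b. ((\<lambda>t. (unrot \<circ> \<sigma>) (t *s b)) has_derivative (\<lambda>t. t *s v)) (at 0)"
    if "v \<in> tangent_plane A B C p" for v
  proof -
    have "rot v \<in> tangent_plane B C A (rot p)"
      using that by (simp add: tangent_plane_rot)
    from bspec[OF c(8) this]
    obtain b where b: "((\<lambda>t. \<sigma> (t *s b)) has_derivative (\<lambda>t. t *s rot v)) (at 0)"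
      by (rule exE)
    have "(unrot has_derivative unrot) (at q)" for q
    proof -
      have "((\<lambda>p. vector [p $ 3, p $ 1, p $ 2] :: complex^3) has_derivative (\<lambda>p. vector [p $ 3, p $ 1, p $ 2])) (at q)"
        by (intro has_derivative_vector_3 has_derivative_component)
      then show ?thesis
        by (simp add: unrot_def[abs_def])
    qed
    from has_derivative_compose[OF b this]
    show ?thesis
      by (auto simp: rot_unrot_scale)
  qed
  moreover have "inj_on (unrot \<circ> \<sigma>) (ball 0 \<delta>)"
    using c(4) by (metis (no_types, lifting) comp_apply inj_on_def rot_unrot(1))
  moreover have "continuous_on (ball 0 \<delta>) (unrot \<circ> \<sigma>)"
    using c(5) holomorphic_map_continuous[OF holomorphic_map_unrot]
    by (intro continuous_on_compose) (auto intro: continuous_on_subset)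
  moreover have "(unrot \<circ> \<sigma>) ` ball 0 \<delta> \<subseteq> surface A B C D \<inter> U"
    using c(3) by (auto simp: unrot_surface)
  ultimately show ?thesis
    unfolding surface_chart_def using c(1,2) by simp
qed

text \<open>At most two rotations bring a nonvanishing gradient entry to the third place.\<close>

lemma surface_chart_exists:
  assumes "smooth_point A B C D p" "open U" "p \<in> U"
  obtains \<sigma> \<delta> where "surface_chart A B C D p U \<sigma> \<delta>"
proof -
  have unrot_step: "\<exists>\<sigma> \<delta>. surface_chart A B C D p U \<sigma> \<delta>"
    if "\<And>V. open V \<Longrightarrow> rot p \<in> V \<Longrightarrow> \<exists>\<sigma> \<delta>. surface_chart B C A D (rot p) V \<sigma> \<delta>" "open U" "p \<in> U"
    for A B C D p U
  proof -
    have "open (unrot -` U)"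
      using open_vimage[OF that(2) holomorphic_map_continuous[OF holomorphic_map_unrot]] .
    then show ?thesis
      using that(1)[of "unrot -` U"] that(3) surface_chart_unrot by force
  qed
  have chart_3: "\<exists>\<sigma> \<delta>. surface_chart A B C D p U \<sigma> \<delta>"
    if "p \<in> surface A B C D" "surface_grad A B C p $ 3 \<noteq> 0" "open U" "p \<in> U" for A B C D p U
    using surface_chart_grad_3[OF that] by blast
  have p: "p \<in> surface A B C D" "surface_grad A B C p \<noteq> 0"
    using assms(1) by (simp_all add: smooth_point_def)
  then consider "surface_grad A B C p $ 1 \<noteq> 0" | "surface_grad A B C p $ 2 \<noteq> 0" | "surface_grad A B C p $ 3 \<noteq> 0"
    by (auto simp: vec_eq_iff forall_3)
  then have "\<exists>\<sigma> \<delta>. surface_chart A B C D p U \<sigma> \<delta>"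
  proof cases
    case 1
    then have "\<exists>\<sigma> \<delta>. surface_chart B C A D (rot p) V \<sigma> \<delta>" if "open V" "rot p \<in> V" for V
      using that p(1) chart_3[of "rot p" B C A D V] by (simp add: surface_rot surface_grad_rot)
    then show ?thesis
      using unrot_step[OF _ assms(2,3)] by blast
  next
    case 2
    then have "\<exists>\<sigma> \<delta>. surface_chart C A B D (rot (rot p)) V \<sigma> \<delta>" if "open V" "rot (rot p) \<in> V" for V
      using that p(1) chart_3[of "rot (rot p)" C A B D V] by (simp add: surface_rot surface_grad_rot)
    then have "\<exists>\<sigma> \<delta>. surface_chart B C A D (rot p) V \<sigma> \<delta>" if "open V" "rot p \<in> V" for V
      using unrot_step[OF _ that] by blast
    then show ?thesis
      using unrot_step[OF _ assms(2,3)] by blast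
  next
    case 3
    then show ?thesis
      using p(1) assms(2,3) by (intro chart_3)
  qed
  then show ?thesis using that by blast
qed

section \<open>Normality of families of holomorphic maps\<close>

lemma norm_vector_scalar_mult_complex:
  fixes b :: "complex^'n" shows "norm (t *s b) = norm t * norm b"
  by (simp add: norm_vec_def norm_mult L2_set_right_distrib)

lemma norm_le_sum_components:
  fixes v :: "complex^3" shows "norm v \<le> norm (v $ 1) + norm (v $ 2) + norm (v $ 3)"
  using L2_set_le_sum[of UNIV "\<lambda>i. norm (v $ i)"] by (simp add: norm_vec_def sum_3)

text \<open>This form of holomorphy suffices because the theorem of Schottky and the Schwarz lemma
  are applied on discs in complex lines.\<close>

definition line_holomorphic_on :: "(complex^2 \<Rightarrow> complex) \<Rightarrow> (complex^2) set \<Rightarrow> bool" where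
  "line_holomorphic_on h S \<longleftrightarrow>
     (\<forall>a b T. (\<forall>t\<in>T. a + t *s b \<in> S) \<longrightarrow> (\<lambda>t. h (a + t *s b)) holomorphic_on T)"

lemma line_holomorphic_on_subset:
  "line_holomorphic_on h S \<Longrightarrow> S' \<subseteq> S \<Longrightarrow> line_holomorphic_on h S'"
  unfolding line_holomorphic_on_def by blast

lemma line_in_ball:
  fixes u b :: "complex^2"
  assumes "norm u < r" "norm t * norm b \<le> s" "r + s \<le> \<delta>"
  shows "u + t *s b \<in> ball 0 \<delta>"
  using assms norm_triangle_ineq[of u "t *s b"] by (simp add: norm_vector_scalar_mult_complex)

text \<open>Two points of the small ball lie in a disc of a complex line inside the large ball,
  where the one-variable theorem applies after \<open>a\<close> and \<open>b\<close> are moved to 0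
  and 1. The bound is uniform in \<open>h\<close>, \<open>\<delta>\<close>, \<open>u\<close> and
  \<open>v\<close>.\<close>

lemma Schottky_ball:
  fixes a b :: complex
  assumes "a \<noteq> b"
  obtains M where "\<And>h \<delta> u v. \<lbrakk>line_holomorphic_on h (ball 0 \<delta>); \<And>x. x \<in> ball 0 \<delta> \<Longrightarrow> h x \<noteq> a \<and> h x \<noteq> b;
      u \<in> ball 0 (\<delta> / 6); v \<in> ball 0 (\<delta> / 6); norm (h u) \<le> K\<rbrakk> \<Longrightarrow> norm (h v) \<le> M"
proof -
  define r where "r = (K + norm a) / norm (b - a)"
  define E where "E = exp (pi * exp (pi * (2 + 2 * r + 12 * (1/2) / (1 - 1/2))))"
  show ?thesis
  proof (rule that)
    fix h \<delta> and u v :: "complex^2"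
    assume h: "line_holomorphic_on h (ball 0 \<delta>)" "\<And>x. x \<in> ball 0 \<delta> \<Longrightarrow> h x \<noteq> a \<and> h x \<noteq> b"
      and uv: "u \<in> ball 0 (\<delta> / 6)" "v \<in> ball 0 (\<delta> / 6)" and K: "norm (h u) \<le> K"
    have \<delta>: "\<delta> > 0"
      using uv(1) norm_ge_zero[of u] by (simp del: norm_ge_zero)
    \<comment> \<open>The factor 2 puts \<open>v\<close> at the parameter \<open>1/2\<close>, where
      \<open>E\<close> is the bound of Schottky.\<close>
    let ?d = "2 *s (v - u)"
    have "norm ?d \<le> 4 * (\<delta> / 6)"
      unfolding norm_vector_scalar_mult_complex using uv norm_triangle_ineq4[of v u] by simp
    then have in_ball: "u + t *s ?d \<in> ball 0 \<delta>" if "t \<in> cball 0 1" for t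
      using uv \<delta> that mult_mono[of "norm t" 1 "norm ?d" "4 * (\<delta> / 6)"]
      by (intro line_in_ball[of _ "\<delta> / 6" _ _ "4 * (\<delta> / 6)"]) auto
    define f where "f = (\<lambda>t. (h (u + t *s ?d) - a) / (b - a))"
    have "(\<lambda>t. h (u + t *s ?d)) holomorphic_on cball 0 1"
      using h(1) in_ball unfolding line_holomorphic_on_def by blast
    then have "f holomorphic_on cball 0 1"
      unfolding f_def using assms by (intro holomorphic_intros) auto
    moreover have "norm (f 0) \<le> r"
      using K norm_triangle_ineq4[of "h u" a] by (simp add: f_def r_def norm_divide divide_right_mono)
    moreover have "\<not> (f t = 0 \<or> f t = 1)" if "t \<in> cball 0 1" for t
      using h(2)[OF in_ball[OF that]] assms by (simp add: f_def)
    ultimately have "norm (f (1/2)) \<le> E"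
      unfolding E_def by (rule Schottky) auto
    moreover have "u + (1/2) *s ?d = v"
      by (simp add: vec_eq_iff)
    then have "h v = a + (b - a) * f (1/2)"
      using assms by (simp add: f_def)
    ultimately show "norm (h v) \<le> norm a + norm (b - a) * E"
      using norm_triangle_ineq[of a "(b - a) * f (1/2)"]
        mult_left_mono[of "norm (f (1/2))" E "norm (b - a)"] by (simp add: norm_mult)
  qed
qed

text \<open>The Schwarz lemma on the complex line through \<open>u\<close> and
  \<open>v\<close>.\<close>

lemma bounded_line_holomorphic_Lipschitz:
  assumes h: "line_holomorphic_on h (ball 0 \<eta>)" "\<And>x. x \<in> ball 0 \<eta> \<Longrightarrow> norm (h x) \<le> M"
    and uv: "u \<in> ball 0 (\<eta> / 6)" "v \<in> ball 0 (\<eta> / 6)"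
  shows "norm (h v - h u) \<le> 2 * (2 * M + 1) / \<eta> * norm (v - u)"
proof (cases "u = v")
  case False
  \<comment> \<open>Stretches the direction to length \<open>\<eta> / 2\<close>; then
    \<open>v\<close> sits at the parameter \<open>1 / s\<close>.\<close>
  define s where "s = \<eta> / 2 / norm (v - u)"
  have \<eta>: "\<eta> > 0"
    using uv(1) norm_ge_zero[of u] by (simp del: norm_ge_zero)
  have M: "M \<ge> 0"
    using h(2)[of 0] \<eta> norm_ge_zero[of "h 0"] by (simp del: norm_ge_zero)
  have nv: "norm (v - u) < \<eta> / 2" "norm (v - u) > 0"
    using uv \<eta> norm_triangle_ineq4[of v u] False by auto
  let ?d = "of_real s *s (v - u)"
  have s: "s > 0" "norm ?d = \<eta> / 2"
    unfolding norm_vector_scalar_mult_complex using nv \<eta> by (auto simp: s_def norm_divide norm_mult)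
  have in_ball: "u + t *s ?d \<in> ball 0 \<eta>" if "t \<in> ball 0 1" for t
    using uv that mult_right_mono[of "norm t" 1 "norm ?d"] s \<eta>
    by (intro line_in_ball[of _ "\<eta> / 6" _ _ "\<eta> / 2"]) auto
  \<comment> \<open>Dividing by \<open>2 * M + 1\<close> makes the bound strict and the denominator
    nonzero even for \<open>M = 0\<close>.\<close>
  define f where "f = (\<lambda>t. (h (u + t *s ?d) - h u) / of_real (2 * M + 1))"
  have nz: "complex_of_real (2 * M + 1) \<noteq> 0"
    using M by (simp del: of_real_add of_real_mult)
  have "(\<lambda>t. h (u + t *s ?d)) holomorphic_on ball 0 1"
    using h(1) in_ball unfolding line_holomorphic_on_def by blast
  then have "f holomorphic_on ball 0 1"
    unfolding f_def using nz by (intro holomorphic_intros) auto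
  moreover have "f 0 = 0"
    by (simp add: f_def)
  moreover have "norm (f t) < 1" if "norm t < 1" for t
  proof -
    have "norm (h (u + t *s ?d) - h u) \<le> M + M"
      using h(2)[OF in_ball[of t]] h(2)[of u] uv that \<eta>
      by (intro order_trans[OF norm_triangle_ineq4] add_mono) auto
    then show ?thesis
      using M unfolding f_def norm_divide norm_of_real by (simp add: divide_less_eq)
  qed
  moreover have "norm (complex_of_real (1 / s)) < 1"
    using nv \<eta> s(1) by (simp add: s_def norm_divide)
  ultimately have "norm (f (of_real (1 / s))) \<le> norm (complex_of_real (1 / s))"
    by (rule Schwarz_Lemma(1))
  moreover have "u + of_real (1 / s) *s ?d = v"
    using s(1) by (simp add: vec_eq_iff)
  ultimately have "norm (h v - h u) / (2 * M + 1) \<le> 1 / s"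
    using M s(1) unfolding f_def norm_divide norm_of_real by simp
  then show ?thesis
    using M s(1) nv \<eta> by (simp add: s_def field_simps)
qed simp

text \<open>The values at 0 decide. If they tend to infinity, so do all others, since by Schottky a
  bounded value anywhere bounds the one at 0. Otherwise a subsequence is bounded at 0, hence on the
  ball of radius \<open>\<delta> / 6\<close>, hence Lipschitz on that of radius
  \<open>\<delta> / 36\<close>, which contains the closed ball of radius
  \<open>\<delta> / 42\<close>.\<close>

lemma Montel_ball:
  fixes F :: "nat \<Rightarrow> complex^2 \<Rightarrow> complex^3" and a b :: "3 \<Rightarrow> complex"
  assumes hol: "\<And>n i. line_holomorphic_on (\<lambda>u. F n u $ i) (ball 0 \<delta>)"
    and omit: "\<And>n i u. u \<in> ball 0 \<delta> \<Longrightarrow> F n u $ i \<noteq> a i \<and> F n u $ i \<noteq> b i"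
    and ab: "\<And>i. a i \<noteq> b i" and \<delta>: "\<delta> > 0"
  shows "(\<exists>r g. strict_mono r \<and> uniform_limit (cball 0 (\<delta> / 42)) (F \<circ> r) g sequentially) \<or>
     (\<forall>K. finite {n. \<exists>u\<in>cball 0 (\<delta> / 42). norm (F n u) \<le> K})"
proof -
  have "\<exists>M. \<forall>n u v. u \<in> ball 0 (\<delta> / 6) \<longrightarrow> v \<in> ball 0 (\<delta> / 6) \<longrightarrow> norm (F n u $ i) \<le> K \<longrightarrow> norm (F n v $ i) \<le> M" for i K
  proof (rule Schottky_ball[OF ab[of i], where K = K])
    fix M
    assume M: "\<And>h \<delta> u v. \<lbrakk>line_holomorphic_on h (ball 0 \<delta>); \<And>x. x \<in> ball 0 \<delta> \<Longrightarrow> h x \<noteq> a i \<and> h x \<noteq> b i;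
      u \<in> ball 0 (\<delta> / 6); v \<in> ball 0 (\<delta> / 6); norm (h u) \<le> K\<rbrakk> \<Longrightarrow> norm (h v) \<le> M"
    show ?thesis
      by (intro exI[of _ M] allI impI) (rule M[OF hol omit])
  qed
  then obtain M where M: "\<And>i K n u v. u \<in> ball 0 (\<delta> / 6) \<Longrightarrow> v \<in> ball 0 (\<delta> / 6) \<Longrightarrow> norm (F n u $ i) \<le> K \<Longrightarrow> norm (F n v $ i) \<le> M i K"
    by metis
  show ?thesis
  proof (cases "\<forall>K. finite {n. norm (F n 0) \<le> K}")
    case True
    have "{n. \<exists>u\<in>cball 0 (\<delta> / 42). norm (F n u) \<le> K} \<subseteq> {n. norm (F n 0) \<le> M 1 K + M 2 K + M 3 K}" for K
    proof safe
      fix n u assume u: "u \<in> cball 0 (\<delta> / 42)" "norm (F n u) \<le> K"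
      have "norm (F n u $ i) \<le> K" for i
        using u(2) Finite_Cartesian_Product.norm_nth_le[of "F n u" i] by linarith
      then have "norm (F n 0 $ i) \<le> M i K" for i
        using M[of u 0 n i K] u(1) \<delta> by auto
      from this[of 1] this[of 2] this[of 3] show "norm (F n 0) \<le> M 1 K + M 2 K + M 3 K"
        using norm_le_sum_components[of "F n 0"] by linarith
    qed
    from finite_subset[OF this spec[OF True]] show ?thesis
      by blast
  next
    case False
    then obtain K where K: "infinite {n. norm (F n 0) \<le> K}" by blast
    define r0 where "r0 = enumerate {n. norm (F n 0) \<le> K}"
    have r0: "strict_mono r0" "\<And>n. norm (F (r0 n) 0) \<le> K"
      using strict_mono_enumerate[OF K] enumerate_in_set[OF K] by (auto simp: r0_def)
    let ?M = "\<lambda>i. M i K"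
    have bound: "norm (F (r0 n) u $ i) \<le> ?M i" if "u \<in> ball 0 (\<delta> / 6)" for n u i
      using M[of 0 u "r0 n" i K] that \<delta> r0(2)[of n] Finite_Cartesian_Product.norm_nth_le[of "F (r0 n) 0" i]
      by auto
    define c where "c = (\<lambda>i. 2 * (2 * ?M i + 1) / (\<delta> / 6))"
    have lip: "norm (F (r0 n) v $ i - F (r0 n) u $ i) \<le> c i * norm (v - u)"
      if "u \<in> cball 0 (\<delta> / 42)" "v \<in> cball 0 (\<delta> / 42)" for n u v i
      unfolding c_def
      using that \<delta> bound
      by (intro bounded_line_holomorphic_Lipschitz[OF line_holomorphic_on_subset[OF hol]]) auto
    have Lip: "norm (F (r0 n) v - F (r0 n) u) \<le> (c 1 + c 2 + c 3) * norm (v - u)"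
      if "u \<in> cball 0 (\<delta> / 42)" "v \<in> cball 0 (\<delta> / 42)" for n u v
      using norm_le_sum_components[of "F (r0 n) v - F (r0 n) u"] lip[OF that, of n 1] lip[OF that, of n 2] lip[OF that, of n 3]
      by (simp add: distrib_right)
    have M0: "?M i \<ge> 0" for i
      using bound[of 0 0 i] \<delta> norm_ge_zero[of "F (r0 0) 0 $ i"] by (simp del: norm_ge_zero)
    have "c i > 0" for i
      using M0[of i] \<delta> by (simp add: c_def)
    then have L: "c 1 + c 2 + c 3 > 0"
      by (simp add: add_pos_pos)
    have equicont: "\<exists>d. 0 < d \<and> (\<forall>n y. y \<in> cball 0 (\<delta> / 42) \<and> norm (x - y) < d \<longrightarrow> norm (F (r0 n) x - F (r0 n) y) < e)"
      if "x \<in> cball 0 (\<delta> / 42)" "0 < e" for x e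
    proof (intro exI conjI allI impI)
      show "0 < e / (c 1 + c 2 + c 3)" using L that(2) by simp
      fix n y assume y: "y \<in> cball 0 (\<delta> / 42) \<and> norm (x - y) < e / (c 1 + c 2 + c 3)"
      have "norm (F (r0 n) x - F (r0 n) y) \<le> (c 1 + c 2 + c 3) * norm (x - y)"
        using Lip y that by blast
      also have "\<dots> < e"
        using y L by (simp add: less_divide_eq mult.commute)
      finally show "norm (F (r0 n) x - F (r0 n) y) < e" .
    qed
    have "norm (F (r0 n) x) \<le> ?M 1 + ?M 2 + ?M 3" if "x \<in> cball 0 (\<delta> / 42)" for n x
      using norm_le_sum_components[of "F (r0 n) x"] bound[of x n 1] bound[of x n 2] bound[of x n 3] that \<delta>
      by force
    then obtain g k where k: "strict_mono (k :: nat \<Rightarrow> nat)"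
      "\<And>e. 0 < e \<Longrightarrow> \<exists>N. \<forall>n x. n \<ge> N \<and> x \<in> cball 0 (\<delta> / 42) \<longrightarrow> norm (F (r0 (k n)) x - g x) < e"
      using Arzela_Ascoli[OF compact_cball _ equicont] by metis
    have "uniform_limit (cball 0 (\<delta> / 42)) (F \<circ> (r0 \<circ> k)) g sequentially"
      unfolding uniform_limit_iff eventually_sequentially dist_norm comp_def using k(2) by blast
    then show ?thesis
      using strict_mono_o[OF r0(1) k(1)] by blast
  qed
qed

section \<open>Parabolic points and the Julia set\<close>

lemma fatou_if_no_parabolic_points:
  assumes p: "smooth_point A B C D p" and U: "open U" "p \<in> U" "U \<inter> parabolic_points A B C D = {}"
  shows "p \<in> fatou_set A B C D"
proof -
  let ?S = "surface A B C D"
  obtain \<sigma> \<delta> where chart: "surface_chart A B C D p U \<sigma> \<delta>"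
    using surface_chart_exists[OF p U(1,2)] .
  have \<delta>: "\<delta> > 0" and \<sigma>0: "\<sigma> 0 = p" and \<sigma>: "\<sigma> ` ball 0 \<delta> \<subseteq> ?S \<inter> U" "inj_on \<sigma> (ball 0 \<delta>)"
    and op: "\<And>\<eta>. \<eta> \<le> \<delta> \<Longrightarrow> openin (top_of_set ?S) (\<sigma> ` ball 0 \<eta>)"
    and hol: "\<And>a b T i. \<forall>t\<in>T. a + t *s b \<in> ball 0 \<delta> \<Longrightarrow> (\<lambda>t. \<sigma> (a + t *s b) $ i) holomorphic_on T"
    using chart unfolding surface_chart_def by simp_all
  obtain a1 b1 where r1: "a1 \<in> resonant_values A B C D" "b1 \<in> resonant_values A B C D" "a1 \<noteq> b1"
    using two_resonant_values .
  obtain a2 b2 where r2: "a2 \<in> resonant_values B C A D" "b2 \<in> resonant_values B C A D" "a2 \<noteq> b2"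
    using two_resonant_values .
  obtain a3 b3 where r3: "a3 \<in> resonant_values C A B D" "b3 \<in> resonant_values C A B D" "a3 \<noteq> b3"
    using two_resonant_values .
  define a :: "3 \<Rightarrow> complex" where "a = (\<lambda>i. if i = 1 then a1 else if i = 2 then a2 else a3)"
  define b :: "3 \<Rightarrow> complex" where "b = (\<lambda>i. if i = 1 then b1 else if i = 2 then b2 else b3)"
  have ab: "a i \<noteq> b i" for i
    using r1 r2 r3 by (simp add: a_def b_def)
  \<comment> \<open>A resonant coordinate would make \<open>w (\<sigma> u)\<close> parabolic and, by
    invariance under the group, also the point \<open>\<sigma> u\<close> of
    \<open>U\<close>.\<close>
  have omit: "w (\<sigma> u) $ i \<noteq> a i \<and> w (\<sigma> u) $ i \<noteq> b i"
    if w: "w \<in> even_words A B C" and u: "u \<in> ball 0 \<delta>" for w u i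
  proof -
    have "w (\<sigma> u) \<in> ?S"
      using \<sigma>(1) u even_words_surface[OF w] by blast
    moreover have "w (\<sigma> u) \<notin> parabolic_points A B C D"
      using \<sigma>(1) u U(3) parabolic_points_even_words_iff[OF w] by blast
    ultimately have "w (\<sigma> u) $ 1 \<notin> resonant_values A B C D" "w (\<sigma> u) $ 2 \<notin> resonant_values B C A D"
      "w (\<sigma> u) $ 3 \<notin> resonant_values C A B D"
      using parabolic_points_resonant_1 parabolic_points_resonant_2 parabolic_points_resonant_3 by blast+
    then show ?thesis
      using r1 r2 r3 exhaust_3[of i] by (auto simp: a_def b_def)
  qed
  let ?N = "\<sigma> ` ball 0 (\<delta> / 42)"
  have "normal_family_on ?S (surface_group A B C D) ?N"
    unfolding normal_family_on_def
  proof (intro allI impI)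
    fix f :: "nat \<Rightarrow> complex^3 \<Rightarrow> complex^3" assume f: "\<forall>n. f n \<in> surface_group A B C D"
    then have "\<forall>n. \<exists>w. w \<in> even_words A B C \<and> f n = restrict w ?S"
      unfolding surface_group_eq by blast
    then obtain w where w: "\<And>n. w n \<in> even_words A B C" "\<And>n. f n = restrict (w n) ?S"
      by metis
    have f_eq: "f n (\<sigma> u) = w n (\<sigma> u)" if "u \<in> ball 0 \<delta>" for n u
    proof -
      have "\<sigma> u \<in> ?S" using \<sigma>(1) that by blast
      then show ?thesis using w(2) by simp
    qed
    have "line_holomorphic_on (\<lambda>u. w n (\<sigma> u) $ i) (ball 0 \<delta>)" for n i
      unfolding line_holomorphic_on_def
    proof (intro allI impI)
      fix c d :: "complex^2" and T assume "\<forall>t\<in>T. c + t *s d \<in> ball 0 \<delta>"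
      then show "(\<lambda>t. w n (\<sigma> (c + t *s d)) $ i) holomorphic_on T"
        by (intro holomorphic_map_holomorphic[OF even_words_holomorphic_map[OF w(1)]] hol)
    qed
    from Montel_ball[where F = "\<lambda>n u. w n (\<sigma> u)", OF this omit[OF w(1)] ab \<delta>]
    consider r g where "strict_mono r" "uniform_limit (cball 0 (\<delta> / 42)) ((\<lambda>n u. w n (\<sigma> u)) \<circ> r) g sequentially"
      | "\<And>K. finite {n. \<exists>u\<in>cball 0 (\<delta> / 42). norm (w n (\<sigma> u)) \<le> K}"
      by blast
    then show "\<exists>r. strict_mono r \<and> (converges_uniformly_on_compacts ?N (f \<circ> r) \<or> converges_to_infinity_on ?S ?N (f \<circ> r))"
    proof cases
      case 1
      \<comment> \<open>The limit is carried to the surface by the inverse of the chart.\<close>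
      have "uniform_limit ?N (f \<circ> r) (\<lambda>q. g (inv_into (ball 0 \<delta>) \<sigma> q)) sequentially"
        unfolding uniform_limit_iff
      proof (intro allI impI)
        fix e :: real assume "e > 0"
        then have "\<forall>\<^sub>F n in sequentially. \<forall>u\<in>cball 0 (\<delta> / 42). dist (w (r n) (\<sigma> u)) (g u) < e"
          using 1(2) unfolding uniform_limit_iff by simp
        then show "\<forall>\<^sub>F n in sequentially. \<forall>q\<in>?N. dist ((f \<circ> r) n q) (g (inv_into (ball 0 \<delta>) \<sigma> q)) < e"
        proof eventually_elim
          case (elim n)
          have "dist (f (r n) (\<sigma> u)) (g (inv_into (ball 0 \<delta>) \<sigma> (\<sigma> u))) < e" if "u \<in> ball 0 (\<delta> / 42)" for u
          proof -
            have "u \<in> ball 0 \<delta>" "u \<in> cball 0 (\<delta> / 42)" using that \<delta> by auto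
            then show ?thesis using elim f_eq \<sigma>(2) by simp
          qed
          then show ?case by (auto simp del: mem_ball)
        qed
      qed
      then have "converges_uniformly_on_compacts ?N (f \<circ> r)"
        unfolding converges_uniformly_on_compacts_def using uniform_limit_on_subset by blast
      then show ?thesis using 1(1) by blast
    next
      case 2
      have "finite {i. f i ` V \<inter> K \<noteq> {}}" if V: "V \<subseteq> ?N" and K: "compact K" for V K
      proof -
        obtain k where k: "\<And>x. x \<in> K \<Longrightarrow> norm x \<le> k"
          using compact_imp_bounded[OF K] bounded_iff by metis
        have "{i. f i ` V \<inter> K \<noteq> {}} \<subseteq> {n. \<exists>u\<in>cball 0 (\<delta> / 42). norm (w n (\<sigma> u)) \<le> k}"
        proof (intro subsetI CollectI)
          fix i assume "i \<in> {i. f i ` V \<inter> K \<noteq> {}}"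
          then obtain u where u: "u \<in> ball 0 (\<delta> / 42)" "f i (\<sigma> u) \<in> K"
            using V by blast
          then have "u \<in> ball 0 \<delta>" "u \<in> cball 0 (\<delta> / 42)" using \<delta> by auto
          then show "\<exists>u\<in>cball 0 (\<delta> / 42). norm (w i (\<sigma> u)) \<le> k"
            using u(2) k f_eq by metis
        qed
        then show ?thesis using 2 finite_subset by blast
      qed
      \<comment> \<open>The whole sequence escapes, so \<open>id\<close> serves as the
        subsequence.\<close>
      then have "converges_to_infinity_on ?S ?N (f \<circ> id)"
        by (simp add: converges_to_infinity_on_def)
      moreover have "strict_mono (id :: nat \<Rightarrow> nat)"
        by (simp add: strict_mono_def)
      ultimately show ?thesis by blast
    qed
  qed
  moreover have "p \<in> ?N"
    using \<sigma>0 \<delta> by force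
  moreover have "openin (top_of_set ?S) ?N"
    using op[of "\<delta> / 42"] \<delta> by simp
  moreover have "p \<in> ?S"
    using p by (simp add: smooth_point_def)
  ultimately show ?thesis
    unfolding fatou_set_def by blast
qed

section \<open>Instability at parabolic points\<close>

lemma unipotent_funpow:
  assumes L: "complex_derivative_at w L q" "L (L \<xi> - \<xi>) = L \<xi> - \<xi>"
  shows "(L ^^ m) \<xi> = \<xi> + of_nat m *s (L \<xi> - \<xi>)"
proof (induction m)
  case (Suc m)
  have "(L ^^ Suc m) \<xi> = L (\<xi> + of_nat m *s (L \<xi> - \<xi>))"
    using Suc by simp
  also have "\<dots> = L \<xi> + of_nat m *s L (L \<xi> - \<xi>)"
    using complex_derivative_at_linear(2,3)[OF L(1)] by metis
  also have "\<dots> = \<xi> + of_nat (Suc m) *s (L \<xi> - \<xi>)"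
    unfolding L(2) by (simp add: vec_eq_iff algebra_simps)
  finally show ?case .
qed simp

text \<open>Uniform convergence near \<open>q\<close> would bound the derivatives of the iterates by
  Cauchy's inequality, but along \<open>\<xi>\<close> they grow linearly.\<close>

lemma parabolic_points_subset_julia:
  "parabolic_points A B C D \<subseteq> julia_set A B C D"
proof
  let ?S = "surface A B C D"
  fix q assume "q \<in> parabolic_points A B C D"
  then obtain w L \<xi> where w: "smooth_point A B C D q" "w \<in> even_words A B C" "w q = q"
    and L: "complex_derivative_at w L q" "\<xi> \<in> tangent_plane A B C q" "L \<xi> \<noteq> \<xi>" "L (L \<xi> - \<xi>) = L \<xi> - \<xi>"
    by (auto simp: parabolic_points_def parabolic_point_def)
  have qS: "q \<in> ?S"
    using w(1) by (simp add: smooth_point_def)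
  have wn: "(w ^^ n) \<in> even_words A B C" for n
    by (rule even_words_funpow[OF w(2)])
  have fixq: "(w ^^ n) q = q" for n
    using w(3) by (induction n) auto
  have "q \<notin> fatou_set A B C D"
  proof
    assume "q \<in> fatou_set A B C D"
    then obtain U where U: "openin (top_of_set ?S) U" "q \<in> U" "normal_family_on ?S (surface_group A B C D) U"
      unfolding fatou_set_def by blast
    obtain W where W: "open W" "U = ?S \<inter> W"
      using U(1) by (auto simp: openin_open)
    define f where "f = (\<lambda>n. restrict (w ^^ n) ?S)"
    have "\<forall>n. f n \<in> surface_group A B C D"
      unfolding f_def surface_group_eq using wn by blast
    then obtain r where r: "strict_mono r"
      "converges_uniformly_on_compacts U (f \<circ> r) \<or> converges_to_infinity_on ?S U (f \<circ> r)"
      using U(3) unfolding normal_family_on_def by blast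
    \<comment> \<open>Every iterate fixes \<open>q\<close>, so the compact set \<open>{q}\<close> is
      met infinitely often.\<close>
    have "\<not> converges_to_infinity_on ?S U (f \<circ> r)"
    proof
      assume "converges_to_infinity_on ?S U (f \<circ> r)"
      then have "finite {i. (f \<circ> r) i ` {q} \<inter> {q} \<noteq> {}}"
        unfolding converges_to_infinity_on_def
        by (elim allE[of _ "{q}"]) (use U(2) qS in simp)
      moreover have "{i. (f \<circ> r) i ` {q} \<inter> {q} \<noteq> {}} = UNIV"
        using fixq qS by (simp add: f_def)
      ultimately show False by simp
    qed
    then obtain g where g: "\<And>V. compact V \<Longrightarrow> V \<subseteq> U \<Longrightarrow> uniform_limit V (f \<circ> r) g sequentially"
      using r(2) unfolding converges_uniformly_on_compacts_def by blast
    have "q \<in> W" using U(2) W(2) by blast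
    obtain \<sigma> \<delta> where chart: "surface_chart A B C D q W \<sigma> \<delta>"
      using surface_chart_exists[OF w(1) W(1) \<open>q \<in> W\<close>] .
    have \<delta>: "\<delta> > 0" and \<sigma>0: "\<sigma> 0 = q" and \<sigma>: "\<sigma> ` ball 0 \<delta> \<subseteq> ?S \<inter> W" "continuous_on (ball 0 \<delta>) \<sigma>"
      and hol: "\<And>a b T i. \<forall>t\<in>T. a + t *s b \<in> ball 0 \<delta> \<Longrightarrow> (\<lambda>t. \<sigma> (a + t *s b) $ i) holomorphic_on T"
      and "\<exists>b. ((\<lambda>t. \<sigma> (t *s b)) has_derivative (\<lambda>t. t *s \<xi>)) (at 0)"
      using chart L(2) unfolding surface_chart_def by simp_all
    then obtain b where b: "((\<lambda>t. \<sigma> (t *s b)) has_derivative (\<lambda>t. t *s \<xi>)) (at 0)"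
      by blast
    \<comment> \<open>Keeps the parameter disc inside the chart; the summand 1 avoids a zero
      denominator.\<close>
    define \<rho> where "\<rho> = \<delta> / (2 * (norm b + 1))"
    have \<rho>: "\<rho> > 0" "\<rho> * norm b \<le> \<delta> / 2"
      using \<delta> by (auto simp: \<rho>_def field_simps add_pos_nonneg)
    have in_ball: "0 + t *s b \<in> ball 0 \<delta>" if "t \<in> cball 0 \<rho>" for t
      using that \<rho> \<delta> mult_right_mono[of "norm t" \<rho> "norm b"]
      by (intro line_in_ball[of _ "\<delta> / 2" _ _ "\<delta> / 2"]) auto
    define c where "c = (\<lambda>t. \<sigma> (0 + t *s b))"
    have c_hol: "(\<lambda>t. c t $ i) holomorphic_on cball 0 \<rho>" for i
      unfolding c_def using in_ball by (intro hol) blast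
    let ?V = "c ` cball 0 \<rho>"
    have "continuous_on (cball 0 \<rho>) c"
      unfolding c_def
      by (rule continuous_on_compose2[OF \<sigma>(2) continuous_on_scalar_mult_line]) (use in_ball in blast)
    then have "compact ?V"
      by (intro compact_continuous_image) simp_all
    moreover have VU: "?V \<subseteq> U"
      unfolding c_def using in_ball \<sigma>(1) W(2) by blast
    ultimately have lim: "uniform_limit ?V (f \<circ> r) g sequentially"
      by (rule g)
    obtain i where i: "(L \<xi> - \<xi>) $ i \<noteq> 0"
      using L(3) by (metis eq_iff_diff_eq_0 vec_eq_iff zero_index)
    define h where "h = (\<lambda>n t. (w ^^ r n) (c t) $ i)"
    have h_hol: "h n holomorphic_on cball 0 \<rho>" for n
      unfolding h_def by (intro holomorphic_map_holomorphic[OF even_words_holomorphic_map[OF wn]] c_hol)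
    obtain N where N: "\<And>n x. n \<ge> N \<Longrightarrow> x \<in> ?V \<Longrightarrow> dist (f (r n) x) (g x) < 1"
      using lim unfolding uniform_limit_iff eventually_sequentially
      by (metis comp_apply zero_less_one)
    \<comment> \<open>The iterates are compared with the continuous \<open>h N\<close>, since
      \<open>g\<close> comes without regularity.\<close>
    have close: "norm (h n t - h N t) \<le> 2" if "n \<ge> N" "t \<in> cball 0 \<rho>" for n t
    proof -
      have "c t \<in> ?V" "c t \<in> ?S"
        using that VU W(2) by auto
      then have "dist ((w ^^ r n) (c t)) (g (c t)) < 1" "dist ((w ^^ r N) (c t)) (g (c t)) < 1"
        using N[of n "c t"] N[of N "c t"] that by (simp_all add: f_def)
      then have "dist ((w ^^ r n) (c t)) ((w ^^ r N) (c t)) < 2"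
        using dist_triangle2[of "(w ^^ r n) (c t)" "(w ^^ r N) (c t)" "g (c t)"] by linarith
      then show ?thesis
        using dist_vec_nth_le[of "(w ^^ r n) (c t)" i "(w ^^ r N) (c t)"] by (simp add: h_def dist_norm)
    qed
    have "compact (h N ` cball 0 \<rho>)"
      using h_hol holomorphic_on_imp_continuous_on by (intro compact_continuous_image) auto
    then obtain K where K: "\<And>t. t \<in> cball 0 \<rho> \<Longrightarrow> norm (h N t) \<le> K"
      using compact_imp_bounded bounded_iff by (metis imageI)
    have bound: "norm (\<xi> $ i + of_nat (r n) * (L \<xi> - \<xi>) $ i) \<le> (K + 2) / \<rho>" if "n \<ge> N" for n
    proof -
      have "complex_derivative_at (w ^^ r n) (L ^^ r n) (\<sigma> (0 *s b))"
        using complex_derivative_at_funpow[OF L(1) w(3)] \<sigma>0 by simp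
      note D = this
      have "((\<lambda>t. (w ^^ r n) (\<sigma> (t *s b))) has_derivative (\<lambda>t. (L ^^ r n) (t *s \<xi>))) (at 0)"
        using has_derivative_compose[OF b] D unfolding complex_derivative_at_def by blast
      from has_derivative_compose[OF this has_derivative_component[of i]]
      have "((\<lambda>t. (w ^^ r n) (\<sigma> (t *s b)) $ i) has_derivative (\<lambda>t. (L ^^ r n) (t *s \<xi>) $ i)) (at 0)" .
      moreover have "(\<lambda>t. (L ^^ r n) (t *s \<xi>) $ i) = (*) ((L ^^ r n) \<xi> $ i)"
        by (simp add: fun_eq_iff complex_derivative_at_linear(3)[OF D] mult.commute)
      ultimately have "(h n has_field_derivative (L ^^ r n) \<xi> $ i) (at 0)"
        by (simp add: has_field_derivative_def h_def c_def)
      then have d: "deriv (h n) 0 = \<xi> $ i + of_nat (r n) * (L \<xi> - \<xi>) $ i"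
        using unipotent_funpow[OF L(1,4), of "r n"] by (simp add: DERIV_imp_deriv right_diff_distrib)
      have "norm ((deriv ^^ 1) (h n) 0) \<le> fact 1 * (K + 2) / \<rho> ^ 1"
      proof (rule Cauchy_inequality)
        show "h n holomorphic_on ball 0 \<rho>"
          using h_hol by (rule holomorphic_on_subset) auto
        show "continuous_on (cball 0 \<rho>) (h n)"
          using h_hol by (rule holomorphic_on_imp_continuous_on)
        fix t :: complex assume "norm (0 - t) = \<rho>"
        then have "t \<in> cball 0 \<rho>" by simp
        then show "norm (h n t) \<le> K + 2"
          using close[OF that, of t] K[of t] norm_triangle_sub[of "h n t" "h N t"] by linarith
      qed (rule \<rho>(1))
      then show ?thesis using d by simp
    qed
    \<comment> \<open>Since \<open>r n \<ge> n \<ge> m\<close>, the linear growth exceeds the Cauchy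
      bound.\<close>
    obtain m where m: "real m * norm ((L \<xi> - \<xi>) $ i) > (K + 2) / \<rho> + norm (\<xi> $ i)"
      using ex_less_of_nat_mult i by (metis zero_less_norm_iff)
    define n where "n = max m N"
    have "norm (of_nat (r n) * (L \<xi> - \<xi>) $ i) \<le> (K + 2) / \<rho> + norm (\<xi> $ i)"
      using bound[of n] norm_diff_ineq[of "of_nat (r n) * (L \<xi> - \<xi>) $ i" "\<xi> $ i"] by (simp add: n_def add.commute)
    moreover have "m \<le> r n"
      using strict_mono_imp_increasing[OF r(1), of n] by (simp add: n_def)
    then have "real m * norm ((L \<xi> - \<xi>) $ i) \<le> norm (of_nat (r n) * (L \<xi> - \<xi>) $ i)"
      unfolding norm_mult norm_of_nat by (intro mult_right_mono) simp_all
    ultimately show False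
      using m by linarith
  qed
  then show "q \<in> julia_set A B C D"
    using qS by (simp add: julia_set_def)
qed

section \<open>Jordan form of the derivative on the tangent plane\<close>

text \<open>A nonzero gradient makes the tangent plane a proper subspace of
  \<open>complex^3\<close>, of dimension at most 2, so two independent vectors span it.\<close>

lemma tangent_plane_basis:
  assumes grad: "surface_grad A B C q \<noteq> 0"
    and tan: "\<tau> \<in> tangent_plane A B C q" "\<xi> \<in> tangent_plane A B C q" "v \<in> tangent_plane A B C q"
    and indep: "\<tau> \<noteq> 0" "\<And>k. \<xi> \<noteq> k *s \<tau>"
  obtains k l where "v = k *s \<tau> + l *s \<xi>"
proof -
  let ?T = "tangent_plane A B C q"
  have T: "?T \<noteq> UNIV"
    using grad tangent_plane_UNIV by blast
  have dim: "vec.dim (UNIV :: (complex^3) set) = 3"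
    unfolding vec_dim_card by simp
  have "vec.dim ?T \<noteq> 3"
    using vec.subspace_dim_equal[OF subspace_tangent_plane vec.subspace_UNIV subset_UNIV, of A B C q] T
    unfolding dim by auto
  moreover have "vec.dim ?T \<le> 3"
    using vec.dim_subset[OF subset_UNIV, of ?T] unfolding dim .
  ultimately have "vec.dim ?T \<le> 2" by linarith
  have "\<xi> \<notin> vec.span {\<tau>}"
    using indep(2) by (auto simp: vec.span_singleton)
  then have ind: "vec.independent {\<xi>, \<tau>}"
    using indep(1) by (simp add: vec.independent_insertI)
  have "\<xi> \<noteq> \<tau>"
    using indep(2)[of 1] by simp
  then have "?T \<subseteq> vec.span {\<xi>, \<tau>}"
    using \<open>vec.dim ?T \<le> 2\<close> tan by (intro vec.card_ge_dim_independent ind) auto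
  then have "v \<in> vec.span {\<xi>, \<tau>}"
    using tan(3) by blast
  then obtain l k where "v - l *s \<xi> = k *s \<tau>"
    by (auto simp: vec.span_breakdown_eq[of _ \<xi>] vec.span_singleton)
  then have "v = k *s \<tau> + l *s \<xi>"
    by (metis diff_add_cancel)
  then show ?thesis by (rule that)
qed

lemma parabolic_point_deriv_conjugate:
  assumes "parabolic_point A B C D w q"
  shows "surface_deriv_conjugate_to A B C D (restrict w (surface A B C D)) q (vector [vector [1, 1], vector [0, 1]])"
proof -
  let ?S = "surface A B C D"
  obtain L \<xi> where w: "smooth_point A B C D q" "w \<in> even_words A B C" "w q = q"
    and L: "complex_derivative_at w L q" "\<xi> \<in> tangent_plane A B C q" "L \<xi> \<noteq> \<xi>" "L (L \<xi> - \<xi>) = L \<xi> - \<xi>"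
    using assms by (auto simp: parabolic_point_def)
  note Ls = complex_derivative_at_linear[OF L(1)]
  define \<tau> where "\<tau> = L \<xi> - \<xi>"
  have \<tau>: "L \<tau> = \<tau>" "\<tau> \<noteq> 0" "L \<xi> = \<xi> + \<tau>"
    using L(3,4) by (simp_all add: \<tau>_def)
  have comb: "k *s \<tau> + l *s \<xi> \<in> tangent_plane A B C q" if "\<tau> \<in> tangent_plane A B C q" for k l
    using that L(2) by (intro vec.subspace_add vec.subspace_scale subspace_tangent_plane)
  have "L \<xi> \<in> tangent_plane A B C (w q)"
    using tangent_plane_image[OF L(1) surface_poly_even_words[OF w(2)]] L(2) by blast
  then have \<tau>_tan: "\<tau> \<in> tangent_plane A B C q"
    using L(2) w(3) unfolding \<tau>_def by (simp add: vec.subspace_diff subspace_tangent_plane)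
  \<comment> \<open>A multiple of \<open>\<tau>\<close> would be fixed by \<open>L\<close>, unlike
    \<open>\<xi>\<close>.\<close>
  have indep: "\<xi> \<noteq> k *s \<tau>" for k
    using Ls(3) \<tau> L(3) by metis
  \<comment> \<open>The Jordan basis, with \<open>\<tau>\<close> first:
    \<open>L \<tau> = \<tau>\<close> and \<open>L \<xi> = \<xi> + \<tau>\<close> are the columns of
    the matrix.\<close>
  define \<phi> :: "complex^2 \<Rightarrow> complex^3" where "\<phi> = (\<lambda>u. u $ 1 *s \<tau> + u $ 2 *s \<xi>)"
  have "Vector_Spaces.linear (*s) (*s) \<phi>"
    unfolding Vector_Spaces.linear_iff
    by (auto simp: \<phi>_def vec_eq_iff algebra_simps intro: vec.vector_space_axioms)
  moreover have "bij_betw \<phi> UNIV (tangent_plane A B C q)"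
  proof (rule bij_betwI')
    fix u v :: "complex^2"
    show "\<phi> u = \<phi> v \<longleftrightarrow> u = v"
    proof
      assume e: "\<phi> u = \<phi> v"
      \<comment> \<open>\<open>L - id\<close> extracts the second coordinate; comparing multiples of
        \<open>\<tau>\<close> then gives the first.\<close>
      then have "L (\<phi> u) - \<phi> u = L (\<phi> v) - \<phi> v" by simp
      moreover have "L (\<phi> x) - \<phi> x = x $ 2 *s \<tau>" for x
        by (simp add: \<phi>_def Ls \<tau> vec_eq_iff algebra_simps)
      ultimately have "u $ 2 = v $ 2"
        using \<tau>(2) by simp
      moreover from this have "u $ 1 *s \<tau> = v $ 1 *s \<tau>"
        using e by (simp add: \<phi>_def)
      then have "u $ 1 = v $ 1"
        using \<tau>(2) by simp
      ultimately show "u = v"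
        by (simp add: vec_eq_iff forall_2)
    qed simp
  next
    fix u show "\<phi> u \<in> tangent_plane A B C q"
      unfolding \<phi>_def by (rule comb[OF \<tau>_tan])
  next
    fix v assume v: "v \<in> tangent_plane A B C q"
    obtain k l where "v = k *s \<tau> + l *s \<xi>"
      using tangent_plane_basis[OF _ \<tau>_tan L(2) v \<tau>(2) indep] w(1) unfolding smooth_point_def by blast
    then have "v = \<phi> (vector [k, l])"
      by (simp add: \<phi>_def)
    then show "\<exists>u\<in>UNIV. v = \<phi> u" by blast
  qed
  moreover have "L (\<phi> u) = \<phi> (vector [vector [1, 1], vector [0, 1]] *v u)" for u
    by (simp add: \<phi>_def Ls \<tau> vec_eq_iff matrix_vector_mult_def sum_2 algebra_simps)
  moreover have "(restrict w ?S has_derivative L) (at q within ?S)"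
  proof (rule has_derivative_transform)
    show "(w has_derivative L) (at q within ?S)"
      using L(1) by (simp add: complex_derivative_at_def has_derivative_at_withinI)
  qed (use w(1) in \<open>simp_all add: smooth_point_def\<close>)
  ultimately show ?thesis
    unfolding surface_deriv_conjugate_to_def by blast
qed

theorem theoremB:
  fixes A B C D :: complex
  shows "\<exists>J. J \<subseteq> julia_set A B C D \<and> julia_set A B C D \<subseteq> closure J \<and>
           (\<forall>p\<in>J. smooth_point A B C D p \<and>
              (\<exists>\<gamma>\<in>surface_group A B C D. \<gamma> p = p \<and>
                 surface_deriv_conjugate_to A B C D \<gamma> p (vector [vector [1, 1], vector [0, 1]])))"
proof (intro exI[of _ "parabolic_points A B C D"] conjI ballI subsetI)
  fix p assume "p \<in> parabolic_points A B C D"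
  then show "p \<in> julia_set A B C D"
    using parabolic_points_subset_julia by blast
next
  fix p assume p: "p \<in> julia_set A B C D"
  then have pS: "p \<in> surface A B C D"
    by (simp add: julia_set_def)
  show "p \<in> closure (parabolic_points A B C D)"
  proof (cases "surface_grad A B C p = 0")
    case True
    then show ?thesis
      using pS by (rule singular_point_in_closure_parabolic_points[rotated])
  next
    case False
    then have sm: "smooth_point A B C D p"
      using pS by (simp add: smooth_point_def)
    show ?thesis
    \<comment> \<open>Otherwise the complement of the closure is a neighbourhood of the smooth point
      \<open>p\<close> without parabolic points, which puts \<open>p\<close> into the Fatou
      set.\<close>
    proof (rule ccontr)
      assume "p \<notin> closure (parabolic_points A B C D)"
      then have "p \<in> - closure (parabolic_points A B C D)" by simp
      moreover have "open (- closure (parabolic_points A B C D))"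
        by (simp add: open_Compl)
      moreover have "- closure (parabolic_points A B C D) \<inter> parabolic_points A B C D = {}"
        using closure_subset[of "parabolic_points A B C D"] by blast
      ultimately have "p \<in> fatou_set A B C D"
        using fatou_if_no_parabolic_points[OF sm] by blast
      then show False
        using p by (simp add: julia_set_def)
    qed
  qed
next
  fix p assume "p \<in> parabolic_points A B C D"
  then obtain w where w: "parabolic_point A B C D w p"
    by (auto simp: parabolic_points_def)
  then show "smooth_point A B C D p"
    by (simp add: parabolic_point_def)
  have "restrict w (surface A B C D) \<in> surface_group A B C D"
    using w unfolding surface_group_eq parabolic_point_def by blast
  moreover have "restrict w (surface A B C D) p = p"
    using w by (simp add: parabolic_point_def smooth_point_def)
  ultimately show "\<exists>\<gamma>\<in>surface_group A B C D. \<gamma> p = p \<and>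
      surface_deriv_conjugate_to A B C D \<gamma> p (vector [vector [1, 1], vector [0, 1]])"
    using parabolic_point_deriv_conjugate[OF w] by blast
qed

end
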